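(* Let $(K,v)$ be a valued field with characteristic exponent $p$, and let $(L/K,v)$, $L=K(\theta)$, be a finite Galois extension of valued fields which is immediate. Let $H\neq\{\mathrm{id}\}$ be a subgroup of $\mathrm{Gal}(L/K)$, with fixed field $K_H$, and set $$S_H=\min S(\theta,H)-D_1(\theta,K_H).$$ Then $I_{S_H}\subseteq I_H$. Moreover, if $|H|\le p$ and $$v\left(\frac{\sigma\theta-\theta}{\theta-a}\right)\ge 0\quad\text{for every } a\in K_H \text{ and every } \sigma\in H,$$ then $I_{S_H}=I_H$.
   Context: $v$ is a valuation on a fixed algebraic closure $\overline K$ of $K$ (written additively, with $v(0)=\infty$), restricted to all intermediate fields. For $K\subseteq L\subseteq\overline K$, $vL$ is the value group and $Lv$ the residue field of $(L,v)$; $Kv$ is regarded as a subfield of $Lv$. $(L/K,v)$ is immediate if $vL=vK$ and $Lv=Kv$. The characteristic exponent $p$ of $(K,v)$ is $1$ if $\mathrm{char}(Kv)=0$ and $\mathrm{char}(Kv)$ otherwise. For a subgroup $H$ of $\mathrm{Gal}(L/K)$: $K_H=\{b\in L\mid \sigma b=b \text{ for all }\sigma\in H\}$; $S(\theta,H)=\{v(\sigma\theta-\theta)\mid \sigma\in H\setminus\{\mathrm{id}\}\}$ (a finite set); $D_1(\theta,K_H)=\{v(\theta-c)\mid c\in K_H\}$. For an element $s$ and a set $D$ of values, $s-D=\{s-d\mid d\in D\}$. For a subset $S\subseteq vL$, $I_S=\{c\in L\mid vc\ge s\text{ for some }s\in S\}$ (so $0\in I_S$ if $S\ne\emptyset$).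 For $\sigma\in\mathrm{Gal}(L/K)$, $I_\sigma=\{c\in L\mid vc\ge v\left(\frac{\sigma b-b}{b}\right)\text{ for some } b\in L^*\}$, and $I_H=\bigcup_{\sigma\in H}I_\sigma$. *)

theory Defs
  imports "HOL-Algebra.Algebra" "HOL-Library.Extended"
begin

section \<open>Valuations\<close>

text \<open>
  Values lie in the ordered abelian group \<open>'g\<close> extended by \<open>Pinf\<close>, the value of zero.
  The other infinite element \<open>Minf\<close> of the library type is never a value of a valuation.
\<close>

locale valuation = field R for R (structure) +
  fixes v :: "'a \<Rightarrow> ('g::linordered_ab_group_add) extended"
  assumes val_eq_Pinf_iff: "x \<in> carrier R \<Longrightarrow> v x = Pinf \<longleftrightarrow> x = \<zero>"
    and val_neq_Minf: "x \<in> carrier R \<Longrightarrow> v x \<noteq> Minf"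
    and val_mult: "\<lbrakk>x \<in> carrier R; y \<in> carrier R\<rbrakk> \<Longrightarrow> v (x \<otimes> y) = v x + v y"
    and val_add: "\<lbrakk>x \<in> carrier R; y \<in> carrier R\<rbrakk> \<Longrightarrow> min (v x) (v y) \<le> v (x \<oplus> y)"

definition value_group ::
  "('a, 'm) ring_scheme \<Rightarrow> ('a \<Rightarrow> ('g::linordered_ab_group_add) extended) \<Rightarrow> 'a set \<Rightarrow> 'g extended set"
  where "value_group R v F = v ` (F - {\<zero>\<^bsub>R\<^esub>})"

definition valuation_ring ::
  "('a, 'm) ring_scheme \<Rightarrow> ('a \<Rightarrow> ('g::linordered_ab_group_add) extended) \<Rightarrow> 'a set"
  where "valuation_ring R v = {x \<in> carrier R. v x \<ge> 0}"

definition valuation_ideal ::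
  "('a, 'm) ring_scheme \<Rightarrow> ('a \<Rightarrow> ('g::linordered_ab_group_add) extended) \<Rightarrow> 'a set"
  where "valuation_ideal R v = {x \<in> carrier R. v x > 0}"

text \<open>
  The residue field of a subfield \<open>F\<close> of \<open>R\<close> is realised inside the residue field of \<open>R\<close>,
  as the set of residue classes of the elements of \<open>F\<close> of nonnegative value.  In this way the
  residue field of a subfield of \<open>F\<close> literally is a subset of that of \<open>F\<close>.
\<close>

definition residue_field ::
  "('a, 'm) ring_scheme \<Rightarrow> ('a \<Rightarrow> ('g::linordered_ab_group_add) extended) \<Rightarrow> 'a set \<Rightarrow> 'a set ring"
  where "residue_field R v F =
    ((R\<lparr>carrier := valuation_ring R v\<rparr>) Quot valuation_ideal R v)
      \<lparr>carrier := (\<lambda>x. valuation_ideal R v +>\<^bsub>R\<^esub> x) ` (F \<inter> valuation_ring R v)\<rparr>"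

definition immediate ::
  "('a, 'm) ring_scheme \<Rightarrow> ('a \<Rightarrow> ('g::linordered_ab_group_add) extended) \<Rightarrow> 'a set \<Rightarrow> 'a set \<Rightarrow> bool"
  where "immediate R v K L \<longleftrightarrow>
    value_group R v L = value_group R v K \<and>
    carrier (residue_field R v L) = carrier (residue_field R v K)"

text \<open>The library's \<open>ord\<close> is \<open>0\<close> for an element of infinite order.\<close>

definition characteristic :: "('a, 'm) ring_scheme \<Rightarrow> nat"
  where "characteristic R = group.ord (add_monoid R) \<one>\<^bsub>R\<^esub>"

definition characteristic_exponent ::
  "('a, 'm) ring_scheme \<Rightarrow> ('a \<Rightarrow> ('g::linordered_ab_group_add) extended) \<Rightarrow> 'a set \<Rightarrow> nat"
  where "characteristic_exponent R v F =
    (if characteristic (residue_field R v F) = 0 then 1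
     else characteristic (residue_field R v F))"


section \<open>Galois extensions\<close>

text \<open>
  Automorphisms of \<open>L\<close> are extensional functions, as in \<^const>\<open>AutoGroup\<close>, so that the identity
  is \<open>\<lambda>x\<in>L. x\<close> and distinct elements of the group differ on \<open>L\<close>.
\<close>

definition galois_group :: "('a, 'm) ring_scheme \<Rightarrow> 'a set \<Rightarrow> 'a set \<Rightarrow> ('a \<Rightarrow> 'a) monoid"
  where "galois_group R K L = (BijGroup L)
    \<lparr>carrier := {\<sigma> \<in> ring_iso (R\<lparr>carrier := L\<rparr>) (R\<lparr>carrier := L\<rparr>) \<inter> extensional L.
       \<forall>x\<in>K. \<sigma> x = x}\<rparr>"

text \<open>
  Here the ambient field \<open>R\<close> is an algebraic closure of \<open>K\<close>, so every minimal polynomial over \<open>K\<close>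
  has all its roots in \<open>R\<close>; the last two conditions are normality and separability.
\<close>

definition (in ring) finite_galois_extension :: "'a set \<Rightarrow> 'a set \<Rightarrow> bool"
  where "finite_galois_extension K L \<longleftrightarrow>
    subfield K R \<and> subfield L R \<and> K \<subseteq> L \<and> finite_dimension K L \<and>
    (\<forall>x\<in>L. set_mset (roots (Irr K x)) \<subseteq> L) \<and>
    (\<forall>x\<in>L. \<forall>a. count (roots (Irr K x)) a \<le> 1)"

definition fixed_field :: "'a set \<Rightarrow> ('a \<Rightarrow> 'a) set \<Rightarrow> 'a set"
  where "fixed_field L H = {b \<in> L. \<forall>\<sigma>\<in>H. \<sigma> b = b}"


section \<open>Sets of values and ideals\<close>

definition S_values ::
  "('a, 'm) ring_scheme \<Rightarrow> ('a \<Rightarrow> ('g::linordered_ab_group_add) extended) \<Rightarrow> 'a set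
     \<Rightarrow> 'a \<Rightarrow> ('a \<Rightarrow> 'a) set \<Rightarrow> 'g extended set"
  where "S_values R v L \<theta> H = {v (\<sigma> \<theta> \<ominus>\<^bsub>R\<^esub> \<theta>) | \<sigma>. \<sigma> \<in> H - {\<lambda>x\<in>L. x}}"

definition D1_values ::
  "('a, 'm) ring_scheme \<Rightarrow> ('a \<Rightarrow> ('g::linordered_ab_group_add) extended)
     \<Rightarrow> 'a \<Rightarrow> 'a set \<Rightarrow> 'g extended set"
  where "D1_values R v \<theta> F = {v (\<theta> \<ominus>\<^bsub>R\<^esub> c) | c. c \<in> F}"

definition diff_set ::
  "('g::linordered_ab_group_add) extended \<Rightarrow> 'g extended set \<Rightarrow> 'g extended set"
  where "diff_set s D = {s - d | d. d \<in> D}"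

definition I_set ::
  "('a \<Rightarrow> ('g::linordered_ab_group_add) extended) \<Rightarrow> 'a set \<Rightarrow> 'g extended set \<Rightarrow> 'a set"
  where "I_set v L S = {c \<in> L. \<exists>s\<in>S. v c \<ge> s}"

definition I_aut ::
  "('a, 'm) ring_scheme \<Rightarrow> ('a \<Rightarrow> ('g::linordered_ab_group_add) extended) \<Rightarrow> 'a set
     \<Rightarrow> ('a \<Rightarrow> 'a) \<Rightarrow> 'a set"
  where "I_aut R v L \<sigma> =
    {c \<in> L. \<exists>b \<in> L - {\<zero>\<^bsub>R\<^esub>}. v c \<ge> v ((\<sigma> b \<ominus>\<^bsub>R\<^esub> b) \<otimes>\<^bsub>R\<^esub> inv\<^bsub>R\<^esub> b)}"

definition I_subgroup ::
  "('a, 'm) ring_scheme \<Rightarrow> ('a \<Rightarrow> ('g::linordered_ab_group_add) extended) \<Rightarrow> 'a set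
     \<Rightarrow> ('a \<Rightarrow> 'a) set \<Rightarrow> 'a set"
  where "I_subgroup R v L H = (\<Union>\<sigma>\<in>H. I_aut R v L \<sigma>)"

end

theory Submission
  imports Defs
begin

text \<open>
  Let \<open>F\<close> be the fixed field of \<open>H\<close>. The unconditional inclusion is witnessed by \<open>b = \<theta> - a\<close> with
  \<open>a \<in> F\<close>, because \<open>\<sigma> b - b = \<sigma> \<theta> - \<theta>\<close>.

  For the converse, immediacy implies that \<open>v (\<theta> - a)\<close>, \<open>a \<in> F\<close>, has no maximum. Call \<open>r\<close> in the
  algebraic closure near if \<open>v (\<theta> - r) > v (\<theta> - a)\<close> for all \<open>a \<in> F\<close>. For a polynomial \<open>f\<close> with
  \<open>k\<close> near roots, \<open>v (f a) = c + k v (\<theta> - a)\<close> once \<open>v (\<theta> - a)\<close> is large. The integrality hypothesis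
  makes all conjugates \<open>\<sigma> \<theta>\<close> near, so all \<open>n = |H|\<close> roots of \<open>g = \<Prod>(X - \<sigma> \<theta>) \<in> F[X]\<close> are near.

  A nonzero \<open>f \<in> F[X]\<close> of degree \<open>m < n \<le> p\<close> has no near root. Not all its roots can be near: as
  \<open>v m = 0\<close>, their mean would be an element of \<open>F\<close> that is near. If \<open>0 < k < m\<close> of them are near, divide
  \<open>g = f q + r\<close>. By induction \<open>v (r a)\<close> is ultimately constant, so the three terms have values that
  grow like \<open>n\<close>, \<open>l\<close> and \<open>0\<close> times \<open>v (\<theta> - a)\<close> with \<open>0 < l < n\<close>, which is impossible.

  Finally write \<open>b = f \<theta> = c \<Prod>(\<theta> - r)\<close> with \<open>deg f < n\<close>. Then \<open>\<sigma> b / b\<close> is the product of the factors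
  \<open>1 + (\<sigma> \<theta> - \<theta>) / (\<theta> - r)\<close>, and since no \<open>r\<close> is near, some \<open>a \<in> F\<close> satisfies
  \<open>v (\<theta> - r) < v (\<theta> - a)\<close> for all \<open>r\<close>. Hence \<open>v (\<sigma> b / b - 1) \<ge> v (\<sigma> \<theta> - \<theta>) - v (\<theta> - a)\<close>.
\<close>

section \<open>Products of linear factors\<close>

context domain
begin

context
  notes poly_mult.simps [simp del]
begin

text \<open>Polynomials are coefficient lists, leading coefficient first, so
  \<open>[\<one>, \<ominus> r]\<close> is X - r and the whole is the monic polynomial with roots
  \<open>rs\<close>, repeated according to multiplicity.\<close>

definition linear_product :: "'a list \<Rightarrow> 'a list"
  where "linear_product rs = foldr poly_mult (map (\<lambda>r. [\<one>, \<ominus> r]) rs) [\<one>]"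

lemma linear_product_Nil [simp]: "linear_product [] = [\<one>]"
  and linear_product_Cons [simp]:
    "linear_product (r # rs) = poly_mult [\<one>, \<ominus> r] (linear_product rs)"
  by (simp_all add: linear_product_def)

lemma linear_factor_closed:
  "r \<in> carrier R \<Longrightarrow> polynomial (carrier R) [\<one>, \<ominus> r]"
  by (auto simp: polynomial_def)

lemma linear_product_closed:
  "set rs \<subseteq> carrier R \<Longrightarrow> polynomial (carrier R) (linear_product rs)"
  by (induction rs)
    (simp_all add: poly_mult_closed[OF carrier_is_subring] linear_factor_closed
      one_is_polynomial carrier_is_subring)

lemma linear_product_monic:
  assumes "set rs \<subseteq> carrier R"
  shows "length (linear_product rs) = Suc (length rs)" and "lead_coeff (linear_product rs) = \<one>"
proof -
  have "length (linear_product rs) = Suc (length rs) \<and> lead_coeff (linear_product rs) = \<one>"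
    using assms
  proof (induction rs)
    case (Cons r rs)
    let ?l = "[\<one>, \<ominus> r]" and ?p = "linear_product rs"
    have l: "polynomial (carrier R) ?l" and p: "polynomial (carrier R) ?p"
      using Cons.prems by (simp_all add: linear_factor_closed linear_product_closed)
    have p0: "?p \<noteq> []" using Cons by auto
    have "degree (poly_mult ?l ?p) = Suc (length rs)"
      using poly_mult_degree_eq[OF carrier_is_subring l p] p0 Cons by simp
    then have "length (poly_mult ?l ?p) = Suc (Suc (length rs))"
      by linarith
    moreover have "lead_coeff (poly_mult ?l ?p) = \<one>"
      using poly_mult_lead_coeff[OF carrier_is_subring l p _ p0] Cons by simp
    ultimately show ?case by (simp)
  qed simp
  then show "length (linear_product rs) = Suc (length rs)" "lead_coeff (linear_product rs) = \<one>"
    by auto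
qed

text \<open>Vieta's formula for the second coefficient. In the convolution with X - r only the
  indices 0 and 1 survive.\<close>

lemma linear_product_subleading_coeff:
  assumes "set rs \<subseteq> carrier R" "rs \<noteq> []"
  shows "coeff (linear_product rs) (length rs - 1) = \<ominus> foldr (\<oplus>) rs \<zero>"
  using assms
proof (induction rs)
  case (Cons r rs)
  let ?l = "[\<one>, \<ominus> r]" and ?p = "linear_product rs"
  have r: "r \<in> carrier R" and rs: "set rs \<subseteq> carrier R" using Cons.prems by auto
  have s: "foldr (\<oplus>) rs \<zero> \<in> carrier R" using rs by (induction rs) auto
  have p: "set ?p \<subseteq> carrier R" using linear_product_closed[OF rs] polynomial_incl by blast
  have lead: "coeff ?p (length rs) = \<one>"
    using linear_product_monic[OF rs] lead_coeff_simp[of ?p] by fastforce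
  define h where "h k = coeff ?l k \<otimes> coeff ?p (length rs - k)" for k
  have hc: "h k \<in> carrier R" for k
    using p r by (simp add: h_def)
  have h0: "h k = \<zero>" if "1 < k" for k
    using p that by (simp add: h_def)
  have "coeff (poly_mult ?l ?p) (length rs) = (\<Oplus>k\<in>{..length rs}. h k)"
    using poly_mult_coeff[of ?l ?p] p r by (simp add: h_def)
  also have "\<dots> = \<ominus> foldr (\<oplus>) (r # rs) \<zero>"
  \<comment> \<open>For empty \<open>rs\<close> the summation range is {0}: the term
    \<open>h 1\<close> is absent, and the induction hypothesis, which needs a nonempty list, does
    not apply.\<close>
  proof (cases rs)
    case Nil
    then show ?thesis using r by (simp add: h_def)
  next
    case (Cons r' rs')
    have "(\<Oplus>k\<in>{..length rs}. h k) = (\<Oplus>k\<in>{0, 1}. h k)"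
      using Cons hc by (intro add.finprod_mono_neutral_cong_right) (auto intro: h0)
    also have "\<dots> = h 0 \<oplus> h 1"
      using hc by simp
    also have "\<dots> = \<ominus> r \<oplus> \<ominus> foldr (\<oplus>) rs \<zero>"
      using Cons.IH[OF rs] Cons r s lead by (simp add: h_def del: linear_product_Cons)
    finally show ?thesis using r s by (simp add: minus_add)
  qed
  finally show ?case by (simp)
qed simp

lemma eval_linear_product:
  assumes "set rs \<subseteq> carrier R" "x \<in> carrier R"
  shows "eval (linear_product rs) x = foldr (\<lambda>r y. (x \<ominus> r) \<otimes> y) rs \<one>"
  using assms
proof (induction rs)
  case (Cons r rs)
  have "set (linear_product rs) \<subseteq> carrier R"
    by (rule polynomial_incl[OF linear_product_closed]) (use Cons.prems in auto)
  then have "eval (linear_product (r # rs)) x = eval [\<one>, \<ominus> r] x \<otimes> eval (linear_product rs) x"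
    using Cons.prems by (simp only: linear_product_Cons) (intro eval_poly_mult, auto)
  then show ?case using Cons by (simp add: a_minus_def del: linear_product_Cons)
qed simp

lemma eval_linear_product_root:
  assumes "set rs \<subseteq> carrier R" "x \<in> set rs"
  shows "eval (linear_product rs) x = \<zero>"
proof -
  have x: "x \<in> carrier R" using assms by blast
  have closed: "foldr (\<lambda>r y. (x \<ominus> r) \<otimes> y) rs \<one> \<in> carrier R" if "set rs \<subseteq> carrier R" for rs
    using that x by (induction rs) auto
  have "foldr (\<lambda>r y. (x \<ominus> r) \<otimes> y) rs \<one> = \<zero>"
    using assms
  proof (induction rs)
    case (Cons r rs)
    then show ?case using x closed[of rs] by (cases "x = r") (auto simp: a_minus_def r_neg)
  qed simp
  then show ?thesis using eval_linear_product[OF assms(1) x] by simp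
qed

text \<open>Multiplication of polynomials is commutative. Hence an automorphism that permutes the
  conjugates of an element fixes the product of their linear factors.\<close>

lemma linear_product_mset_cong:
  assumes "mset rs = mset rs'" "set rs \<subseteq> carrier R"
  shows "linear_product rs = linear_product rs'"
proof -
  interpret P: cring "poly_ring R" by (rule univ_poly_is_cring[OF carrier_is_subring])
  have "linear_product rs =
      foldr (\<otimes>\<^bsub>poly_ring R\<^esub>) (map (\<lambda>r. [\<one>, \<ominus> r]) rs) \<one>\<^bsub>poly_ring R\<^esub>" for rs
    by (simp add: linear_product_def univ_poly_mult univ_poly_one)
  moreover have "set (map (\<lambda>r. [\<one>, \<ominus> r]) rs) \<subseteq> carrier (poly_ring R)"
    using assms(2) by (auto simp: linear_factor_closed simp flip: univ_poly_carrier)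
  ultimately show ?thesis
    using assms(1) P.multlist_perm_cong[of "map (\<lambda>r. [\<one>, \<ominus> r]) rs" "map (\<lambda>r. [\<one>, \<ominus> r]) rs'"]
    by simp
qed

end

end

section \<open>Factorisation over an algebraically closed field, and the sum of the roots\<close>

lemma (in algebraically_closed) factor_into_linear_product:
  assumes "p \<in> carrier (poly_ring L)" "p \<noteq> []"
  obtains c rs where "c \<in> carrier L - {\<zero>}" "set rs \<subseteq> carrier L" "length rs = degree p"
    "p = poly_mult [c] (linear_product rs)"
proof -
  have "\<exists>c rs. c \<in> carrier L - {\<zero>} \<and> set rs \<subseteq> carrier L \<and> length rs = degree p \<and>
    p = poly_mult [c] (linear_product rs)"
    using assms
  proof (induction "degree p" arbitrary: p)
    case 0
    then obtain c where c: "p = [c]" by (cases p) auto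
    then have "c \<in> carrier L - {\<zero>}"
      using 0 by (auto simp: polynomial_def simp flip: univ_poly_carrier)
    with c show ?case
      by (intro exI[of _ c] exI[of _ "[]"]) auto
  next
    case (Suc n)
    interpret P: domain "poly_ring L" by (rule univ_poly_is_domain[OF carrier_is_subring])
    \<comment> \<open>Since \<open>p\<close> splits, positive degree forces a root; its linear
      factor is divided off and the induction hypothesis is applied to the quotient.\<close>
    have "roots p \<noteq> {#}"
      using roots_over_carrier[OF Suc.prems(1)] Suc.hyps(2) by (auto simp: splitted_def)
    then obtain a where a: "a \<in> carrier L" and pdiv: "[\<one>, \<ominus> a] pdivides p"
      and l: "[\<one>, \<ominus> a] \<in> carrier (poly_ring L)"
      using not_empty_rootsE[OF Suc.prems(1)] by blast
    then obtain q where q: "q \<in> carrier (poly_ring L)" and p: "p = poly_mult [\<one>, \<ominus> a] q"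
      unfolding pdivides_def factor_def by (auto simp: univ_poly_mult)
    have q0: "q \<noteq> []" using p Suc.prems poly_mult_zero(2)[of "[\<one>, \<ominus> a]"] a by auto
    have "degree p = Suc (degree q)"
      using poly_mult_degree_eq[OF carrier_is_subring, of "[\<one>, \<ominus> a]" q] p q l q0
      by (simp add: univ_poly_carrier)
    then have dq: "n = degree q" using Suc.hyps(2) by simp
    obtain c rs where IH: "c \<in> carrier L - {\<zero>}" "set rs \<subseteq> carrier L" "length rs = degree q"
      "q = poly_mult [c] (linear_product rs)"
      using Suc.hyps(1)[OF dq q q0] by blast
    have c: "[c] \<in> carrier (poly_ring L)"
      using IH(1) by (auto simp: polynomial_def simp flip: univ_poly_carrier)
    have lp: "linear_product rs \<in> carrier (poly_ring L)"
      using linear_product_closed[OF IH(2)] by (simp add: univ_poly_carrier)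
    have "p = poly_mult [c] (linear_product (a # rs))"
      using P.m_lcomm[OF l c lp] p IH(4) by (simp add: univ_poly_mult)
    then show ?case
      using IH a \<open>degree p = Suc (degree q)\<close>
      by (intro exI[of _ c] exI[of _ "a # rs"]) (simp del: linear_product_Cons)
  qed
  then show thesis using that by blast
qed

lemma (in domain) coeff_scaled_linear_product:
  assumes "c \<in> carrier R - {\<zero>}" "set rs \<subseteq> carrier R" "p = poly_mult [c] (linear_product rs)"
  shows "coeff p i = c \<otimes> coeff (linear_product rs) i"
proof -
  have "p = map (\<lambda>b. c \<otimes> b) (linear_product rs)"
    using poly_mult_const[OF carrier_is_subring linear_product_closed[OF assms(2)] assms(1)] assms(3)
    by simp
  then show ?thesis using scalar_coeff[of c "linear_product rs"] assms(1) by simp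
qed

lemma (in domain) eval_scaled_linear_product:
  assumes "c \<in> carrier R - {\<zero>}" "set rs \<subseteq> carrier R" "p = poly_mult [c] (linear_product rs)"
    "x \<in> carrier R"
  shows "eval p x = c \<otimes> eval (linear_product rs) x" "eval (linear_product rs) x \<in> carrier R"
proof -
  show lp: "eval (linear_product rs) x \<in> carrier R"
    using eval_poly_in_carrier[OF carrier_is_subring linear_product_closed[OF assms(2)] assms(4)] .
  show "eval p x = c \<otimes> eval (linear_product rs) x"
    using eval_poly_mult[of "[c]" "linear_product rs" x] assms
      polynomial_incl[OF linear_product_closed[OF assms(2)]] by simp
qed

text \<open>The leading coefficient of \<open>p\<close> is \<open>c\<close> and the next one is -c
  times the sum of the roots. Both lie in \<open>F\<close>, even when the single roots do
  not.\<close>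

lemma (in field) sum_of_roots_mem_subfield:
  assumes "subfield F R" "polynomial F p" "c \<in> carrier R - {\<zero>}" "set rs \<subseteq> carrier R"
    "p = poly_mult [c] (linear_product rs)" "rs \<noteq> []"
  shows "foldr (\<oplus>) rs \<zero> \<in> F"
proof -
  note F = subfieldE(1)[OF assms(1)]
  have coeffs: "coeff p i \<in> F" for i
  proof -
    have "coeff p i \<in> set p \<union> {\<zero>}" using coeff_img(3)[of p] by blast
    then show ?thesis using polynomial_incl[OF assms(2)] subringE(2)[OF F] by auto
  qed
  have s: "foldr (\<oplus>) rs \<zero> \<in> carrier R" using assms(4) by (induction rs) auto
  note cf = coeff_scaled_linear_product[OF assms(3-5)]
  have "coeff (linear_product rs) (length rs) = \<one>"
    using linear_product_monic[OF assms(4)] lead_coeff_simp[of "linear_product rs"] by fastforce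
  then have "c \<in> F" using cf[of "length rs"] coeffs[of "length rs"] assms(3) by simp
  then have ic: "inv c \<in> F" using subfield_m_inv(1)[OF assms(1)] assms(3) by blast
  have cs: "coeff p (length rs - 1) = c \<otimes> (\<ominus> foldr (\<oplus>) rs \<zero>)"
    using cf linear_product_subleading_coeff[OF assms(4,6)] by simp
  have "inv c \<otimes> coeff p (length rs - 1) \<in> F"
    using subringE(6)[OF F ic coeffs] .
  moreover have "inv c \<otimes> coeff p (length rs - 1) = \<ominus> foldr (\<oplus>) rs \<zero>"
    using cs s assms(3) subfieldE(3)[OF assms(1)] ic
    by (simp add: field_Units flip: m_assoc)
  ultimately have "\<ominus> (\<ominus> foldr (\<oplus>) rs \<zero>) \<in> F"
    using subringE(5)[OF F] by simp
  then show ?thesis using s by simp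
qed

section \<open>Valuations\<close>

text \<open>Two affine functions of different slopes on an ordered, hence torsion-free, abelian
  group agree in at most one point. The multiple k x is written as a sum of k copies of x.\<close>

lemma sum_const_eq_imp_eq:
  fixes x y c d :: "'g::linordered_ab_group_add" and k l :: nat
  assumes "k < l" "c + (\<Sum>i<k. x) = d + (\<Sum>i<l. x)" "c + (\<Sum>i<k. y) = d + (\<Sum>i<l. y)"
  shows "x = y"
proof -
  have split: "(\<Sum>i<l. z) = (\<Sum>i<k. z) + (\<Sum>i\<in>{k..<l}. z)" for z :: 'g
    using sum.atLeastLessThan_concat[of 0 k l "\<lambda>_. z"] assms(1) by (simp add: lessThan_atLeast0)
  have "c = d + (\<Sum>i\<in>{k..<l}. x)" "c = d + (\<Sum>i\<in>{k..<l}. y)"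
    using assms(2,3) split[of x] split[of y] by (simp_all add: algebra_simps)
  then have eq: "(\<Sum>i\<in>{k..<l}. x) = (\<Sum>i\<in>{k..<l}. y)" by simp
  have "\<not> x < y" "\<not> y < x"
    using assms(1) sum_strict_mono[of "{k..<l}" "\<lambda>_. x" "\<lambda>_. y"]
      sum_strict_mono[of "{k..<l}" "\<lambda>_. y" "\<lambda>_. x"] eq by auto
  then show ?thesis by simp
qed

lemma sum_lessThan_const_add:
  fixes x :: "'g::comm_monoid_add" and k l :: nat
  shows "(\<Sum>i<k + l. x) = (\<Sum>i<k. x) + (\<Sum>i<l. x)"
  by (induction l) (simp_all add: add_ac)

lemma (in abelian_group) minus_minus_cancel:
  assumes "x \<in> carrier G" "y \<in> carrier G" "z \<in> carrier G"
  shows "(x \<ominus> y) \<ominus> (x \<ominus> z) = z \<ominus> y" and "(y \<ominus> x) \<ominus> (z \<ominus> x) = y \<ominus> z"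
proof -
  have "(x \<ominus> y) \<ominus> (x \<ominus> z) = (x \<oplus> \<ominus> x) \<oplus> (z \<oplus> \<ominus> y)"
    using assms by (simp add: a_minus_def minus_add a_ac)
  then show "(x \<ominus> y) \<ominus> (x \<ominus> z) = z \<ominus> y" using assms by (simp add: r_neg a_minus_def)
  have "(y \<ominus> x) \<ominus> (z \<ominus> x) = (x \<oplus> \<ominus> x) \<oplus> (y \<oplus> \<ominus> z)"
    using assms by (simp add: a_minus_def minus_add a_ac)
  then show "(y \<ominus> x) \<ominus> (z \<ominus> x) = y \<ominus> z" using assms by (simp add: r_neg a_minus_def)
qed

context valuation
begin

section \<open>Elementary rules for valuations\<close>

lemma val_zero [simp]: "v \<zero> = Pinf"
  by (simp add: val_eq_Pinf_iff)

lemma val_finiteE: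
  assumes "x \<in> carrier R" "x \<noteq> \<zero>"
  obtains g where "v x = Fin g"
  using assms val_eq_Pinf_iff[of x] val_neq_Minf[of x] by (cases "v x") auto

lemma val_one [simp]: "v \<one> = 0"
proof -
  obtain g where "v \<one> = Fin g" using val_finiteE[OF one_closed] by auto
  with val_mult[of \<one> \<one>] show ?thesis by (simp add: zero_extended_def)
qed

text \<open>The square of -1 is 1, so twice the value of -1 is 0, and the value group has no
  torsion.\<close>

lemma val_a_inv [simp]:
  assumes x: "x \<in> carrier R" shows "v (\<ominus> x) = v x"
proof -
  have m: "\<ominus> \<one> \<noteq> \<zero>" using a_inv_inj by (metis minus_zero one_closed one_not_zero minus_minus)
  then obtain g where g: "v (\<ominus> \<one>) = Fin g" using val_finiteE[of "\<ominus> \<one>"] by auto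
  have "v (\<ominus> \<one>) + v (\<ominus> \<one>) = v (\<ominus> \<one> \<otimes> \<ominus> \<one>)" by (simp add: val_mult)
  also have "\<dots> = 0" by (simp add: l_minus r_minus)
  finally have "g = 0" using g double_zero[of g] by (simp add: zero_extended_def)
  then have "v (\<ominus> \<one> \<otimes> x) = v x"
    using g x by (simp add: val_mult flip: zero_extended_def)
  then show ?thesis using x by (simp add: l_minus)
qed

lemma val_minus_commute:
  assumes "x \<in> carrier R" "y \<in> carrier R" shows "v (x \<ominus> y) = v (y \<ominus> x)"
proof -
  have "y \<ominus> x = \<ominus> (x \<ominus> y)" using assms by (simp add: a_minus_def minus_add a_comm)
  then show ?thesis using assms by simp
qed

lemma val_minus:
  "\<lbrakk>x \<in> carrier R; y \<in> carrier R\<rbrakk> \<Longrightarrow> min (v x) (v y) \<le> v (x \<ominus> y)"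
  using val_add[of x "\<ominus> y"] by (simp add: a_minus_def)

lemma val_add_eq:
  assumes "x \<in> carrier R" "y \<in> carrier R" "v x < v y"
  shows "v (x \<oplus> y) = v x"
proof (rule antisym)
  show "v x \<le> v (x \<oplus> y)" using val_add[OF assms(1,2)] assms(3) by (simp add: min_def split: if_splits)
  have "x \<oplus> y \<ominus> y = x" using assms by (simp add: a_minus_def a_assoc r_neg)
  then have "min (v (x \<oplus> y)) (v y) \<le> v x" using val_minus[of "x \<oplus> y" y] assms by simp
  then show "v (x \<oplus> y) \<le> v x" using assms(3) by (auto simp: min_def split: if_splits)
qed

lemma val_minus_eq:
  assumes "x \<in> carrier R" "y \<in> carrier R" "v x < v y"
  shows "v (x \<ominus> y) = v x" and "v (y \<ominus> x) = v x"
  using val_add_eq[of x "\<ominus> y"] assms val_minus_commute[OF assms(1,2)] by (simp_all add: a_minus_def)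

lemma val_inv:
  assumes "x \<in> carrier R" "x \<noteq> \<zero>"
  shows "inv x \<in> carrier R" and "inv x \<noteq> \<zero>" and "v (inv x) = - v x"
proof -
  have u: "x \<in> Units R" using assms by (simp add: field_Units)
  show i: "inv x \<in> carrier R" using u by simp
  have e: "x \<otimes> inv x = \<one>" using u by simp
  show i0: "inv x \<noteq> \<zero>" using e assms by auto
  obtain g h where gh: "v x = Fin g" "v (inv x) = Fin h"
    using val_finiteE assms i i0 by metis
  have "v x + v (inv x) = 0" using val_mult[OF assms(1) i] e by simp
  then have "g + h = 0" using gh by (simp add: zero_extended_def)
  then show "v (inv x) = - v x" using gh by (metis neg_eq_iff_add_eq_0 uminus_extended.simps(1))
qed

lemma val_div:
  assumes "x \<in> carrier R" "y \<in> carrier R" "y \<noteq> \<zero>"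
  shows "v (x \<otimes> inv y) = v x - v y"
  using assms val_inv[OF assms(2,3)] by (simp add: val_mult minus_extended_def)

end

text \<open>The relative increment of a product is controlled by those of its factors: with a = x -
  r and b = y - x one has (a + b) q - a p = a (q - p) + b q, and s \<ge> 0 gives v p \<le> v q. The
  additive form avoids dividing by a product that may vanish.\<close>

lemma (in valuation) val_linear_product_diff:
  assumes "set rs \<subseteq> carrier R" "x \<in> carrier R" "y \<in> carrier R" "0 \<le> s"
    and "\<And>r. r \<in> set rs \<Longrightarrow> s + v (x \<ominus> r) \<le> v (y \<ominus> x)"
  shows "s + v (eval (linear_product rs) x) \<le>
    v (eval (linear_product rs) y \<ominus> eval (linear_product rs) x)"
  using assms
proof (induction rs)
  case Nil
  then show ?case by (simp add: a_minus_def r_neg)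
next
  case (Cons r rs)
  have r: "r \<in> carrier R" and rs: "set rs \<subseteq> carrier R" using Cons.prems by auto
  have "\<exists>p\<in>carrier R. \<exists>q\<in>carrier R. p = eval (linear_product rs) x \<and> q = eval (linear_product rs) y"
    using eval_poly_in_carrier[OF carrier_is_subring linear_product_closed[OF rs]] Cons.prems by blast
  then obtain p q where pq: "p \<in> carrier R" "q \<in> carrier R"
    "p = eval (linear_product rs) x" "q = eval (linear_product rs) y" by blast
  define a b where "a = x \<ominus> r" and "b = y \<ominus> x"
  have ab: "a \<in> carrier R" "b \<in> carrier R" using r Cons.prems by (simp_all add: a_def b_def)
  have yr: "y \<ominus> r = a \<oplus> b"
  proof -
    have "a \<oplus> b = (x \<oplus> \<ominus> x) \<oplus> (y \<oplus> \<ominus> r)"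
      using Cons.prems r by (simp only: a_def b_def a_minus_def) (simp add: a_ac)
    then show ?thesis using Cons.prems r by (simp add: r_neg a_minus_def)
  qed
  have ev: "eval (linear_product (r # rs)) z = (z \<ominus> r) \<otimes> eval (linear_product rs) z"
    if "z \<in> carrier R" for z
    by (simp only: eval_linear_product[OF rs that] eval_linear_product[OF Cons.prems(1) that]) simp
  have IH: "s + v p \<le> v (q \<ominus> p)"
    using Cons.IH[OF rs Cons.prems(2-4)] Cons.prems(5) pq by simp
  have "v p \<le> s + v p" using Groups.add_mono[OF Cons.prems(4) order_refl, of "v p"] by simp
  moreover have "q = (q \<ominus> p) \<oplus> p" using pq(1,2) by (simp add: a_minus_def a_assoc l_neg)
  then have "min (v (q \<ominus> p)) (v p) \<le> v q" using val_add[of "q \<ominus> p" p] pq(1,2) by simp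
  ultimately have vq: "v p \<le> v q" using IH by (auto simp: min_def split: if_splits)
  have sab: "s + v a \<le> v b" using Cons.prems(5)[of r] by (simp add: a_def b_def)
  have "s + (v a + v p) \<le> v (a \<otimes> (q \<ominus> p))"
    using Groups.add_mono[OF order_refl[of "v a"] IH] ab pq(1,2)
    by (simp add: val_mult Groups.add_ac)
  moreover have "s + (v a + v p) \<le> v (b \<otimes> q)"
    using Groups.add_mono[OF sab vq] ab pq(1,2) by (simp add: val_mult Groups.add_ac)
  ultimately have "s + (v a + v p) \<le> v (a \<otimes> (q \<ominus> p) \<oplus> b \<otimes> q)"
    using val_add[of "a \<otimes> (q \<ominus> p)" "b \<otimes> q"] ab pq(1,2)
    by (auto intro: order_trans simp: min_def split: if_splits)
  moreover have "a \<otimes> (q \<ominus> p) \<oplus> b \<otimes> q = (a \<oplus> b) \<otimes> q \<ominus> a \<otimes> p"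
    using ab pq(1,2) by (simp add: a_minus_def l_distr r_distr r_minus a_ac)
  ultimately have "s + v (a \<otimes> p) \<le> v ((a \<oplus> b) \<otimes> q \<ominus> a \<otimes> p)"
    using ab pq(1) by (simp add: val_mult)
  then show ?case
    using ev[OF Cons.prems(2)] ev[OF Cons.prems(3)] pq(3,4) yr by (simp only: a_def)
qed

section \<open>Roots near an element without best approximation\<close>

text \<open>The values of \<theta> - a for a in \<open>F\<close> have no maximum: \<theta> is a
  pseudo limit of a pseudo Cauchy family in \<open>F\<close> that has no pseudo limit in
  \<open>F\<close>. In particular \<theta> \<notin> \<open>F\<close>.\<close>

locale pseudo_limit = algebraically_closed R + valuation R v
  for R :: "('a, 'm) ring_scheme" (structure)
  and v :: "'a \<Rightarrow> ('g::linordered_ab_group_add) extended" +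
  fixes F :: "'a set" and \<theta> :: 'a
  assumes subfield_F: "subfield F R"
    and theta_closed: "\<theta> \<in> carrier R"
    and no_best_approximation: "a \<in> F \<Longrightarrow> \<exists>a'\<in>F. v (\<theta> \<ominus> a) < v (\<theta> \<ominus> a')"
begin

text \<open>The near elements are the pseudo limits of this family; \<theta> is one of them, and no
  element of \<open>F\<close> is.\<close>

definition near :: "'a \<Rightarrow> bool"
  where "near r \<longleftrightarrow> r \<in> carrier R \<and> (\<forall>a\<in>F. v (\<theta> \<ominus> a) < v (\<theta> \<ominus> r))"

text \<open>Truth on a tail of \<open>F\<close>, directed by the value of \<theta> - a. Tails are
  nonempty and linearly ordered by inclusion, so they form a filter base.\<close>

definition ultimately_true :: "('a \<Rightarrow> bool) \<Rightarrow> bool"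
  where "ultimately_true P \<longleftrightarrow> (\<exists>a\<^sub>0\<in>F. \<forall>a\<in>F. v (\<theta> \<ominus> a\<^sub>0) \<le> v (\<theta> \<ominus> a) \<longrightarrow> P a)"

text \<open>Passes from extended values to the group, where cancellation is available. For a in
  \<open>F\<close> the value is finite, since a larger one exists.\<close>

definition gap :: "'a \<Rightarrow> 'g"
  where "gap a = (THE g. v (\<theta> \<ominus> a) = Fin g)"

section \<open>Values of polynomials on the tails of \<open>F\<close>\<close>

lemma F_closed: "a \<in> F \<Longrightarrow> a \<in> carrier R"
  using subfieldE(3)[OF subfield_F] by blast

lemma F_nonempty: "F \<noteq> {}"
  using subringE(4)[OF subfieldE(1)[OF subfield_F]] .

lemma val_gap: "a \<in> F \<Longrightarrow> v (\<theta> \<ominus> a) = Fin (gap a)"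
proof -
  assume a: "a \<in> F"
  obtain a' where "a' \<in> F" "v (\<theta> \<ominus> a) < v (\<theta> \<ominus> a')" using no_best_approximation[OF a] by blast
  moreover have "v (\<theta> \<ominus> a) \<noteq> Minf" using val_neq_Minf theta_closed F_closed[OF a] by simp
  ultimately obtain g where "v (\<theta> \<ominus> a) = Fin g" by (cases "v (\<theta> \<ominus> a)") auto
  then show ?thesis by (simp add: gap_def)
qed

lemma ultimately_true_conj:
  assumes "ultimately_true P" "ultimately_true Q"
  shows "ultimately_true (\<lambda>a. P a \<and> Q a)"
proof -
  obtain a b where ab: "a \<in> F" "b \<in> F"
    and P: "\<And>c. c \<in> F \<Longrightarrow> v (\<theta> \<ominus> a) \<le> v (\<theta> \<ominus> c) \<Longrightarrow> P c"
    and Q: "\<And>c. c \<in> F \<Longrightarrow> v (\<theta> \<ominus> b) \<le> v (\<theta> \<ominus> c) \<Longrightarrow> Q c"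
    using assms unfolding ultimately_true_def by blast
  show ?thesis
  proof (cases "v (\<theta> \<ominus> a) \<le> v (\<theta> \<ominus> b)")
    case True
    then show ?thesis unfolding ultimately_true_def using ab P Q by (meson order_trans)
  next
    case False
    then have "v (\<theta> \<ominus> b) \<le> v (\<theta> \<ominus> a)" by simp
    then show ?thesis unfolding ultimately_true_def using ab P Q by (meson order_trans)
  qed
qed

lemma ultimately_true_mono:
  assumes "ultimately_true P" "\<And>a. a \<in> F \<Longrightarrow> P a \<Longrightarrow> Q a"
  shows "ultimately_true Q"
  using assms unfolding ultimately_true_def by blast

lemma ultimately_true_ex:
  assumes "ultimately_true P" obtains a where "a \<in> F" "P a"
  using assms unfolding ultimately_true_def by blast

lemma ultimately_trueI: "(\<And>a. a \<in> F \<Longrightarrow> P a) \<Longrightarrow> ultimately_true P"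
  using F_nonempty unfolding ultimately_true_def by blast

text \<open>By the strict ultrametric inequality a near r cannot be told apart from \<theta> by its
  distances to elements of \<open>F\<close>.\<close>

lemma val_minus_near:
  assumes "near r" "a \<in> F" shows "v (a \<ominus> r) = Fin (gap a)"
proof -
  have "v (\<theta> \<ominus> a) < v (\<theta> \<ominus> r)" and r: "r \<in> carrier R" using assms by (auto simp: near_def)
  then have "v ((\<theta> \<ominus> r) \<ominus> (\<theta> \<ominus> a)) = v (\<theta> \<ominus> a)"
    using val_minus_eq(2) theta_closed F_closed assms(2) by simp
  then show ?thesis
    using minus_minus_cancel(1)[OF theta_closed r F_closed[OF assms(2)]] val_gap[OF assms(2)] by simp
qed

lemma ultimately_val_minus_not_near:
  assumes "\<not> near r" "r \<in> carrier R"
  shows "ultimately_true (\<lambda>a. v (a \<ominus> r) = v (\<theta> \<ominus> r) \<and> v (\<theta> \<ominus> r) < v (\<theta> \<ominus> a))"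
proof -
  obtain a where a: "a \<in> F" "v (\<theta> \<ominus> r) \<le> v (\<theta> \<ominus> a)" using assms by (auto simp: near_def)
  \<comment> \<open>Failure of nearness gives only a weak inequality; a better approximation makes
    it strict.\<close>
  then obtain a' where a': "a' \<in> F" "v (\<theta> \<ominus> a) < v (\<theta> \<ominus> a')" using no_best_approximation by blast
  have "v (c \<ominus> r) = v (\<theta> \<ominus> r) \<and> v (\<theta> \<ominus> r) < v (\<theta> \<ominus> c)"
    if c: "c \<in> F" "v (\<theta> \<ominus> a') \<le> v (\<theta> \<ominus> c)" for c
  proof -
    have lt: "v (\<theta> \<ominus> r) < v (\<theta> \<ominus> c)" using a a' c by order
    then have "v ((\<theta> \<ominus> r) \<ominus> (\<theta> \<ominus> c)) = v (\<theta> \<ominus> r)"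
      using val_minus_eq(1) theta_closed F_closed c(1) assms(2) by simp
    then show ?thesis
      using minus_minus_cancel(1)[OF theta_closed assms(2) F_closed[OF c(1)]] lt by simp
  qed
  then show ?thesis using a'(1) unfolding ultimately_true_def by blast
qed

text \<open>Each near root contributes \<open>gap a\<close> and every other root ultimately a
  constant, so the number of near roots is the slope of the value as a function of
  \<open>gap a\<close>.\<close>

lemma val_linear_product:
  assumes "set rs \<subseteq> carrier R"
  obtains c where
    "ultimately_true (\<lambda>a. v (eval (linear_product rs) a) =
       Fin (c + (\<Sum>i<length (filter near rs). gap a)))"
proof -
  have "\<exists>c. ultimately_true (\<lambda>a. v (eval (linear_product rs) a) =
       Fin (c + (\<Sum>i<length (filter near rs). gap a)))"
    using assms
  proof (induction rs)
    case Nil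
    have "ultimately_true (\<lambda>a. v (eval (linear_product []) a) = Fin 0)"
      by (rule ultimately_trueI) (simp add: F_closed zero_extended_def)
    then show ?case by (intro exI[of _ 0]) simp
  next
    case (Cons r rs)
    then obtain c where c: "ultimately_true (\<lambda>a. v (eval (linear_product rs) a) =
       Fin (c + (\<Sum>i<length (filter near rs). gap a)))" by auto
    have r: "r \<in> carrier R" and rs: "set rs \<subseteq> carrier R" using Cons.prems by auto
    have mult: "v (eval (linear_product (r # rs)) a) = v (a \<ominus> r) + v (eval (linear_product rs) a)"
      if "a \<in> F" for a
    proof -
      have "eval (linear_product rs) a \<in> carrier R"
        using eval_poly_in_carrier[OF carrier_is_subring linear_product_closed[OF rs] F_closed[OF that]] .
      moreover have "eval (linear_product (r # rs)) a = (a \<ominus> r) \<otimes> eval (linear_product rs) a"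
        using Cons.prems that by (simp only: eval_linear_product[OF rs F_closed]
            eval_linear_product[OF Cons.prems F_closed]) simp
      ultimately show ?thesis using r that F_closed by (simp add: val_mult)
    qed
    show ?case
    proof (cases "near r")
      case True
      have "ultimately_true (\<lambda>a. v (eval (linear_product (r # rs)) a) =
          Fin (c + (\<Sum>i<length (filter near (r # rs)). gap a)))"
        using c by (rule ultimately_true_mono)
          (simp only: mult val_minus_near[OF True], simp add: True add_ac)
      then show ?thesis by blast
    next
      case False
      \<comment> \<open>The distance of \<theta> to a root that is not near is bounded by a value
        attained on \<open>F\<close>, hence finite.\<close>
      then obtain b where "b \<in> F" "v (\<theta> \<ominus> r) \<le> Fin (gap b)"
        using r val_gap by (auto simp: near_def not_less)
      then obtain g where g: "v (\<theta> \<ominus> r) = Fin g"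
        using val_neq_Minf[of "\<theta> \<ominus> r"] theta_closed r by (cases "v (\<theta> \<ominus> r)") auto
      have "ultimately_true (\<lambda>a. v (eval (linear_product (r # rs)) a) =
          Fin (g + c + (\<Sum>i<length (filter near (r # rs)). gap a)))"
        using ultimately_true_conj[OF c ultimately_val_minus_not_near[OF False r]]
      proof (rule ultimately_true_mono)
        fix a
        assume a: "a \<in> F" and
          "v (eval (linear_product rs) a) = Fin (c + (\<Sum>i<length (filter near rs). gap a)) \<and>
            v (a \<ominus> r) = v (\<theta> \<ominus> r) \<and> v (\<theta> \<ominus> r) < v (\<theta> \<ominus> a)"
        then have "v (eval (linear_product (r # rs)) a) =
            Fin g + Fin (c + (\<Sum>i<length (filter near rs). gap a))"
          using mult[OF a] g by presburger
        then show "v (eval (linear_product (r # rs)) a) =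
            Fin (g + c + (\<Sum>i<length (filter near (r # rs)). gap a))"
          by (simp add: False Groups.add_ac(1) del: linear_product_Cons)
      qed
      then show ?thesis by blast
    qed
  qed
  then show thesis using that by blast
qed

lemma val_poly:
  assumes "c \<in> carrier R - {\<zero>}" "set rs \<subseteq> carrier R" "p = poly_mult [c] (linear_product rs)"
  obtains d where
    "ultimately_true (\<lambda>a. v (eval p a) = Fin (d + (\<Sum>i<length (filter near rs). gap a)))"
proof -
  obtain d where d: "ultimately_true (\<lambda>a. v (eval (linear_product rs) a) =
       Fin (d + (\<Sum>i<length (filter near rs). gap a)))"
    using val_linear_product[OF assms(2)] .
  obtain g where g: "v c = Fin g" using assms(1) val_finiteE by blast
  have "v (eval p a) = v c + v (eval (linear_product rs) a)" if "a \<in> F" for a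
    using eval_scaled_linear_product[OF assms F_closed[OF that]] assms(1) by (simp add: val_mult)
  then have "ultimately_true (\<lambda>a. v (eval p a) =
      Fin (g + d + (\<Sum>i<length (filter near rs). gap a)))"
    using d by (elim ultimately_true_mono) (simp add: g add_ac)
  then show thesis using that by blast
qed

text \<open>Otherwise coincidences would occur arbitrarily far out. As there is no best
  approximation, two of them have different gaps, contradicting
  \<open>sum_const_eq_imp_eq\<close>.\<close>

lemma ultimately_neq:
  fixes k l :: nat
  assumes "k \<noteq> l"
  shows "ultimately_true (\<lambda>a. c + (\<Sum>i<k. gap a) \<noteq> d + (\<Sum>i<l. gap a))"
proof (rule ccontr)
  assume neg: "\<not> ?thesis"
  obtain a where a: "a \<in> F" using F_nonempty by blast
  with neg obtain b where b: "b \<in> F" "c + (\<Sum>i<k. gap b) = d + (\<Sum>i<l. gap b)"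
    unfolding ultimately_true_def by blast
  obtain b' where b': "b' \<in> F" "v (\<theta> \<ominus> b) < v (\<theta> \<ominus> b')" using no_best_approximation b(1) by blast
  with neg obtain e where e: "e \<in> F" "v (\<theta> \<ominus> b') \<le> v (\<theta> \<ominus> e)"
    "c + (\<Sum>i<k. gap e) = d + (\<Sum>i<l. gap e)"
    unfolding ultimately_true_def by blast
  have "gap b = gap e"
    using assms sum_const_eq_imp_eq[of k l c "gap b" d "gap e"]
      sum_const_eq_imp_eq[of l k d "gap b" c "gap e"] b(2) e(3) by (metis linorder_neqE_nat)
  then show False using b(1) b' e(1,2) val_gap by (metis leD)
qed

text \<open>In a relation \<open>x = y + z\<close> the two smallest values agree, whereas values that involve
  different multiples of \<open>gap a\<close> are ultimately distinct.\<close>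

lemma near_count_incompatible:
  fixes k l :: nat
  assumes "ultimately_true (\<lambda>a. v (x a) = Fin (c + (\<Sum>i<k. gap a)))"
    and "ultimately_true (\<lambda>a. v (y a) = Fin (d + (\<Sum>i<l. gap a)))"
    and "ultimately_true (\<lambda>a. v (z a) = Fin e) \<or> (\<forall>a. z a = \<zero>)"
    and "\<And>a. a \<in> F \<Longrightarrow> x a = y a \<oplus> z a"
    and "\<And>a. a \<in> F \<Longrightarrow> y a \<in> carrier R" "\<And>a. a \<in> F \<Longrightarrow> z a \<in> carrier R"
    and "k \<noteq> l" "0 < k" "0 < l"
  shows False
proof -
  have xy: "ultimately_true (\<lambda>a. v (x a) = Fin (c + (\<Sum>i<k. gap a)) \<and>
      v (y a) = Fin (d + (\<Sum>i<l. gap a)) \<and>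
      c + (\<Sum>i<k. gap a) \<noteq> d + (\<Sum>i<l. gap a))"
    using ultimately_true_conj[OF assms(1) ultimately_true_conj[OF assms(2) ultimately_neq[OF assms(7)]]] .
  show False
    using assms(3)
  proof
    assume z: "\<forall>a. z a = \<zero>"
    obtain a where "a \<in> F" "v (x a) \<noteq> v (y a)"
      by (rule ultimately_true_ex[OF xy]) (metis extended.inject)
    then show False using z assms(4,5) by simp
  next
    assume z: "ultimately_true (\<lambda>a. v (z a) = Fin e)"
    \<comment> \<open>The constant \<open>e\<close> is an affine function of slope 0, which differs
      from the positive slopes \<open>k\<close> and \<open>l\<close>.\<close>
    have z': "ultimately_true (\<lambda>a. e \<noteq> c + (\<Sum>i<k. gap a) \<and> e \<noteq> d + (\<Sum>i<l. gap a))"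
      using ultimately_true_conj[OF ultimately_neq[OF less_imp_neq[OF assms(8)], of e c]
          ultimately_neq[OF less_imp_neq[OF assms(9)], of e d]] by simp
    obtain a where "a \<in> F" and
      "(v (x a) = Fin (c + (\<Sum>i<k. gap a)) \<and> v (y a) = Fin (d + (\<Sum>i<l. gap a)) \<and>
        c + (\<Sum>i<k. gap a) \<noteq> d + (\<Sum>i<l. gap a)) \<and>
        v (z a) = Fin e \<and> e \<noteq> c + (\<Sum>i<k. gap a) \<and> e \<noteq> d + (\<Sum>i<l. gap a)"
      by (rule ultimately_true_ex[OF ultimately_true_conj[OF xy ultimately_true_conj[OF z z']]])
    then have a: "a \<in> F" "v (x a) \<noteq> v (y a)" "v (z a) \<noteq> v (x a)" "v (z a) \<noteq> v (y a)"
      by simp_all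
    then consider "v (y a) < v (z a)" | "v (z a) < v (y a)" by (metis linorder_neqE)
    then have "v (x a) = v (y a) \<or> v (x a) = v (z a)"
      using assms(4)[OF a(1)] val_add_eq[of "y a" "z a"] val_add_eq[of "z a" "y a"] assms(5,6)[OF a(1)]
      by cases (auto simp: a_comm)
    then show False using a by auto
  qed
qed

section \<open>Polynomials of small degree have no near root\<close>

lemma polynomial_over_carrier:
  "polynomial F p \<Longrightarrow> p \<in> carrier (poly_ring R)"
  using carrier_polynomial[OF subfieldE(1)[OF subfield_F]] by (simp add: univ_poly_carrier)

text \<open>For m near elements, m \<theta> minus their sum is a sum of differences \<theta> - r, so
  its value exceeds that of every \<theta> - a. Dividing by m, which has value 0, would make the
  mean an element of \<open>F\<close> closer to \<theta> than itself.\<close>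

lemma sum_near_notin:
  assumes "\<And>r. r \<in> set rs \<Longrightarrow> near r" "v ([length rs] \<cdot> \<one>) = 0"
  shows "foldr (\<oplus>) rs \<zero> \<notin> F"
proof
  assume s: "foldr (\<oplus>) rs \<zero> \<in> F"
  let ?m = "[length rs] \<cdot> \<one>" and ?s = "foldr (\<oplus>) rs \<zero>"
  have far: "v (\<theta> \<ominus> a) < v ([length rs] \<cdot> \<one> \<otimes> \<theta> \<ominus> foldr (\<oplus>) rs \<zero>)" if "a \<in> F" for a
    using assms(1)
  proof (induction rs)
    case Nil
    then show ?case using theta_closed val_gap[OF that] by (simp add: a_minus_def)
  next
    case (Cons r rs)
    let ?n = "[length rs] \<cdot> \<one>" and ?t = "foldr (\<oplus>) rs \<zero>"
    have t: "?t \<in> carrier R" using Cons.prems by (induction rs) (auto simp: near_def)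
    have r: "r \<in> carrier R" "v (\<theta> \<ominus> a) < v (\<theta> \<ominus> r)" using Cons.prems that by (auto simp: near_def)
    have n: "?n \<in> carrier R" by simp
    have "[length (r # rs)] \<cdot> \<one> \<otimes> \<theta> \<ominus> foldr (\<oplus>) (r # rs) \<zero> = (?n \<otimes> \<theta> \<ominus> ?t) \<oplus> (\<theta> \<ominus> r)"
      using t r n theta_closed by (simp add: l_distr a_minus_def minus_add a_ac)
    moreover have "min (v (?n \<otimes> \<theta> \<ominus> ?t)) (v (\<theta> \<ominus> r)) \<le> v ((?n \<otimes> \<theta> \<ominus> ?t) \<oplus> (\<theta> \<ominus> r))"
      using val_add t r n theta_closed by simp
    ultimately show ?case using Cons.IH Cons.prems r(2) by (auto simp: min_def split: if_splits)
  qed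
  note F = subfieldE(1)[OF subfield_F]
  have m: "[n] \<cdot> \<one> \<in> F" for n :: nat
    by (induction n) (simp_all add: subringE(2,3,7)[OF F])
  have "?m \<noteq> \<zero>" using assms(2) by (auto simp: zero_extended_def)
  then have im: "inv ?m \<in> F" and e: "?m \<otimes> inv ?m = \<one>"
    using subfield_m_inv(1,2)[OF subfield_F] m by auto
  \<comment> \<open>The mean of the near elements.\<close>
  define b where "b = inv ?m \<otimes> ?s"
  have b: "b \<in> F" using subringE(6)[OF subfieldE(1)[OF subfield_F] im s] by (simp add: b_def)
  have "?m \<otimes> b = ?s"
    using e F_closed[OF im] F_closed[OF s] F_closed[OF m] by (simp add: b_def flip: m_assoc)
  then have "?m \<otimes> \<theta> \<ominus> ?s = ?m \<otimes> (\<theta> \<ominus> b)"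
    using F_closed[OF m] F_closed[OF b] theta_closed by (simp add: a_minus_def r_distr r_minus)
  then have "v (?m \<otimes> \<theta> \<ominus> ?s) = v (\<theta> \<ominus> b)"
    using F_closed[OF m] F_closed[OF b] theta_closed assms(2) by (simp add: val_mult)
  then show False using far[OF b] by simp
qed

text \<open>Strong induction on the degree lets the claim be used for the remainder of dividing
  \<open>linear_product gs\<close> by \<open>p\<close>. Comparing slopes in this division then gives
  the contradiction.\<close>

lemma no_near_roots:
  assumes "set gs \<subseteq> carrier R" "\<And>g. g \<in> set gs \<Longrightarrow> near g" "polynomial F (linear_product gs)"
    and "\<And>m. \<lbrakk>0 < m; m < length gs\<rbrakk> \<Longrightarrow> v ([m] \<cdot> \<one>) = 0"
    and "polynomial F p" "p \<noteq> []" "degree p < length gs"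
    and "c \<in> carrier R - {\<zero>}" "set rs \<subseteq> carrier R" "length rs = degree p"
      "p = poly_mult [c] (linear_product rs)"
  shows "filter near rs = []"
  using assms(5-)
proof (induction "degree p" arbitrary: p c rs rule: less_induct)
  case less
  note F = subfieldE(1)[OF subfield_F]
  let ?g = "linear_product gs"
  let ?k = "length (filter near rs)"
  show ?case
  proof (rule ccontr)
    assume ne: "filter near rs \<noteq> []"
    then have k: "0 < ?k" and rs: "rs \<noteq> []" by auto
    \<comment> \<open>Otherwise the sum of all roots, which lies in \<open>F\<close> by Vieta's
      formula, would be a sum of near elements whose number has value 0.\<close>
    have "?k \<noteq> length rs"
    proof
      assume "?k = length rs"
      then have "\<forall>r\<in>set rs. near r" by (metis length_filter_less less_irrefl)
      moreover have "v ([length rs] \<cdot> \<one>) = 0"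
        using assms(4)[of "length rs"] rs less.prems(3,6) by (metis length_greater_0_conv)
      ultimately show False
        using sum_near_notin[of rs]
          sum_of_roots_mem_subfield[OF subfield_F less.prems(1,4,5,7) rs] by blast
    qed
    then have k_less: "?k < degree p"
      using less.prems(6) by (metis length_filter_le nat_less_le)
    obtain q r where q: "polynomial F q" and r: "polynomial F r"
      and g: "?g = poly_add (poly_mult p q) r" and r_deg: "r = [] \<or> degree r < degree p"
      using field_long_division_theorem[OF subfield_F assms(3) less.prems(1,2)]
      unfolding univ_poly_mult univ_poly_add by metis
    have g_deg: "degree ?g = length gs" "?g \<noteq> []"
      using linear_product_monic[OF assms(1)] by auto
    have pq: "polynomial F (poly_mult p q)" using poly_mult_closed[OF F less.prems(1) q] .
    have q0: "q \<noteq> []"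
    proof
      assume "q = []"
      then have "?g = r"
        using g poly_mult_zero(2)[of p] poly_add_zero(2)[OF F r]
          polynomial_in_carrier[OF F less.prems(1)] by simp
      then show False using g_deg r_deg less.prems(3) by auto
    qed
    have pq_deg: "degree (poly_mult p q) = degree p + degree q"
      using poly_mult_degree_eq[OF F less.prems(1) q] q0 less.prems(2) by simp
    have n: "length gs = degree p + degree q"
    proof (cases "r = []")
      case True
      then show ?thesis using g poly_add_zero(1)[OF F pq] pq_deg g_deg by simp
    next
      case False
      then have "degree r < degree (poly_mult p q)" using r_deg pq_deg by simp
      then show ?thesis
        using poly_add_degree_eq[OF F pq r] g pq_deg g_deg by (simp add: max_def)
    qed
    obtain d qs where d: "d \<in> carrier R - {\<zero>}" "set qs \<subseteq> carrier R" "length qs = degree q"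
      "q = poly_mult [d] (linear_product qs)"
      using factor_into_linear_product[OF polynomial_over_carrier[OF q] q0] .
    let ?l = "length (filter near qs)"
    obtain A where A: "ultimately_true (\<lambda>a. v (eval ?g a) = Fin (A + (\<Sum>i<length (filter near gs). gap a)))"
      using val_linear_product[OF assms(1)] .
    have all_near: "filter near gs = gs" using assms(2) by simp
    obtain B where B: "ultimately_true (\<lambda>a. v (eval p a) = Fin (B + (\<Sum>i<?k. gap a)))"
      using val_poly[OF less.prems(4,5,7)] .
    obtain C where C: "ultimately_true (\<lambda>a. v (eval q a) = Fin (C + (\<Sum>i<?l. gap a)))"
      using val_poly[OF d(1,2,4)] .
    have carr: "eval h a \<in> carrier R" if "polynomial F h" "a \<in> F" for h a
      using eval_poly_in_carrier[OF F that(1) F_closed[OF that(2)]] .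
    have BC: "ultimately_true (\<lambda>a. v (eval p a \<otimes> eval q a) = Fin (B + C + (\<Sum>i<?k + ?l. gap a)))"
      using ultimately_true_conj[OF B C]
    proof (rule ultimately_true_mono)
      fix a
      assume "a \<in> F" and H: "v (eval p a) = Fin (B + (\<Sum>i<?k. gap a)) \<and>
        v (eval q a) = Fin (C + (\<Sum>i<?l. gap a))"
      then show "v (eval p a \<otimes> eval q a) = Fin (B + C + (\<Sum>i<?k + ?l. gap a))"
        using val_mult[OF carr[OF less.prems(1)] carr[OF q]]
        by (simp add: sum_lessThan_const_add Groups.add_ac)
    qed
    \<comment> \<open>By induction a nonzero remainder has no near root, so its value is ultimately
      constant.\<close>
    have Z: "(\<exists>e. ultimately_true (\<lambda>a. v (eval r a) = Fin e)) \<or> (\<forall>a. eval r a = \<zero>)"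
    proof (cases "r = []")
      case False
      obtain d' ss where d': "d' \<in> carrier R - {\<zero>}" "set ss \<subseteq> carrier R" "length ss = degree r"
        "r = poly_mult [d'] (linear_product ss)"
        using factor_into_linear_product[OF polynomial_over_carrier[OF r] False] .
      have deg: "degree r < degree p" using r_deg False by simp
      have "filter near ss = []"
        using less.hyps[OF deg r False _ d'] deg less.prems(3) by simp
      then show ?thesis using val_poly[OF d'(1,2,4)] by auto
    qed simp
    have eq: "eval ?g a = eval p a \<otimes> eval q a \<oplus> eval r a" if "a \<in> F" for a
      using eval_poly_add[of "poly_mult p q" r a] eval_poly_mult[of p q a] g F_closed[OF that]
        polynomial_in_carrier[OF F pq] polynomial_in_carrier[OF F less.prems(1)]
        polynomial_in_carrier[OF F q] polynomial_in_carrier[OF F r] by simp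
    have "?l \<le> degree q" using d(3) by (metis length_filter_le)
    \<comment> \<open>The slope of the value of \<open>p\<close> times \<open>q\<close> is at most k
      + deg q, thus smaller than deg p + deg q = \<open>length gs\<close>, the slope of the value of
      the dividend.\<close>
    then have "length gs \<noteq> ?k + ?l" "0 < length gs" "0 < ?k + ?l" using n k k_less by auto
    then show False
      using Z near_count_incompatible[OF A[unfolded all_near] BC _ eq _ carr[OF r]]
        carr[OF less.prems(1)] carr[OF q] by (metis (no_types, lifting) m_closed)
  qed
qed

text \<open>Finitely many roots, none of them near, are all farther from \<theta> than a single a in
  \<open>F\<close>. Replacing \<theta> by y then changes each linear factor, and so the product, by
  a small relative amount.\<close>

lemma val_log_derivative_bound:
  assumes "c \<in> carrier R - {\<zero>}" "set rs \<subseteq> carrier R" "p = poly_mult [c] (linear_product rs)"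
    and "filter near rs = []" "eval p \<theta> \<noteq> \<zero>"
    and "y \<in> carrier R" "\<And>a. a \<in> F \<Longrightarrow> v (\<theta> \<ominus> a) \<le> v (y \<ominus> \<theta>)"
  shows "\<exists>a\<in>F. v (y \<ominus> \<theta>) - v (\<theta> \<ominus> a) \<le> v ((eval p y \<ominus> eval p \<theta>) \<otimes> inv (eval p \<theta>))"
proof -
  have "ultimately_true (\<lambda>a. \<forall>r\<in>set rs. v (\<theta> \<ominus> r) < v (\<theta> \<ominus> a))"
    using assms(2,4)
  proof (induction rs)
    case Nil
    show ?case by (rule ultimately_trueI) simp
  next
    case (Cons r rs)
    then have r: "\<not> near r" "r \<in> carrier R" and rs: "filter near rs = []" "set rs \<subseteq> carrier R"
      by (auto split: if_splits)
    show ?case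
      by (rule ultimately_true_mono[OF ultimately_true_conj[OF
            ultimately_val_minus_not_near[OF r] Cons.IH[OF rs(2,1)]]]) simp
  qed
  then obtain a where a: "a \<in> F" "\<And>r. r \<in> set rs \<Longrightarrow> v (\<theta> \<ominus> r) < v (\<theta> \<ominus> a)"
    by (rule ultimately_true_ex) blast
  \<comment> \<open>\<open>s\<close> is infinite if y = \<theta>. As the value of \<theta> - a is
    finite, adding it to \<open>s\<close> undoes the subtraction.\<close>
  define s where "s = v (y \<ominus> \<theta>) - v (\<theta> \<ominus> a)"
  have s0: "0 \<le> s" and s: "s + v (\<theta> \<ominus> a) = v (y \<ominus> \<theta>)"
    using assms(7)[OF a(1)] val_gap[OF a(1)]
    by (cases "v (y \<ominus> \<theta>)"; simp add: s_def zero_extended_def)+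
  let ?P = "eval (linear_product rs)"
  have "s + v (\<theta> \<ominus> r) \<le> v (y \<ominus> \<theta>)" if "r \<in> set rs" for r
    using Groups.add_mono[OF order_refl less_imp_le[OF a(2)[OF that]], of s] s by simp
  then have diff: "s + v (?P \<theta>) \<le> v (?P y \<ominus> ?P \<theta>)"
    using val_linear_product_diff[OF assms(2) theta_closed assms(6) s0] by blast
  note ev = eval_scaled_linear_product[OF assms(1-3)]
  have P: "?P \<theta> \<in> carrier R" "?P y \<in> carrier R" "c \<in> carrier R"
    using ev theta_closed assms(1,6) by auto
  have "eval p y \<ominus> eval p \<theta> = c \<otimes> (?P y \<ominus> ?P \<theta>)"
    using ev(1)[OF theta_closed] ev(1)[OF assms(6)] P by (simp add: a_minus_def r_distr r_minus)
  then have "s + v (eval p \<theta>) \<le> v (eval p y \<ominus> eval p \<theta>)"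
    using Groups.add_mono[OF order_refl[of "v c"] diff] ev(1)[OF theta_closed] P
    by (simp add: val_mult Groups.add_ac)
  moreover have "eval p \<theta> \<in> carrier R" "eval p y \<in> carrier R"
    using ev(1) theta_closed assms(6) P by auto
  moreover obtain g where "v (eval p \<theta>) = Fin g"
    using val_finiteE[OF \<open>eval p \<theta> \<in> carrier R\<close> assms(5)] .
  ultimately have "s \<le> v ((eval p y \<ominus> eval p \<theta>) \<otimes> inv (eval p \<theta>))"
    using val_div[OF _ _ assms(5), of "eval p y \<ominus> eval p \<theta>"]
    by (cases s; cases "v (eval p y \<ominus> eval p \<theta>)") (auto simp: algebra_simps)
  then show ?thesis using a(1) s_def by blast
qed

end

section \<open>Immediate extensions and the residue characteristic\<close>

context valuation
begin

section \<open>Residue fields and integer multiples of one\<close>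

lemma val_nat_nonneg: "0 \<le> v ([n] \<cdot> \<one>)" for n :: nat
proof (induction n)
  case (Suc n)
  then show ?case using val_add[of "[n] \<cdot> \<one>" \<one>] by (auto simp: min_def split: if_splits)
qed simp

lemma subring_valuation_ring: "subring (valuation_ring R v) R"
proof (rule subringI)
  fix x y assume xy: "x \<in> valuation_ring R v" "y \<in> valuation_ring R v"
  then show "x \<otimes> y \<in> valuation_ring R v"
    using Groups.add_mono[of 0 "v x" 0 "v y"] by (simp add: valuation_ring_def val_mult)
  show "x \<oplus> y \<in> valuation_ring R v"
    using val_add[of x y] xy by (auto simp: valuation_ring_def min_def split: if_splits)
qed (auto simp: valuation_ring_def)

lemma ideal_valuation_ideal:
  "ideal (valuation_ideal R v) (R\<lparr>carrier := valuation_ring R v\<rparr>)"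
proof (rule idealI)
  let ?O = "R\<lparr>carrier := valuation_ring R v\<rparr>"
  show O: "ring ?O" using subring_is_ring[OF subring_valuation_ring] .
  have "additive_subgroup (valuation_ideal R v) R"
  proof (rule additive_subgroup.intro, rule add.subgroupI)
    show "valuation_ideal R v \<noteq> {}" by (auto simp: valuation_ideal_def zero_extended_def intro!: exI[of _ \<zero>])
    fix x y assume xy: "x \<in> valuation_ideal R v" "y \<in> valuation_ideal R v"
    then show "x \<oplus> y \<in> valuation_ideal R v"
      using val_add[of x y] by (auto simp: valuation_ideal_def min_def split: if_splits)
  qed (auto simp: valuation_ideal_def)
  moreover have "subgroup (valuation_ring R v) (add_monoid R)"
    using subring.axioms(1)[OF subring_valuation_ring] .
  moreover have "valuation_ideal R v \<subseteq> valuation_ring R v"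
    by (auto simp: valuation_ideal_def valuation_ring_def)
  ultimately show "subgroup (valuation_ideal R v) (add_monoid ?O)"
    using add.subgroup_incl[of "valuation_ideal R v" "valuation_ring R v"]
    by (simp add: additive_subgroup_def)
next
  fix a x
  assume a: "a \<in> valuation_ideal R v" and "x \<in> carrier (R\<lparr>carrier := valuation_ring R v\<rparr>)"
  then have x: "x \<in> carrier R" "0 \<le> v x" and a': "a \<in> carrier R" "0 < v a"
    by (auto simp: valuation_ring_def valuation_ideal_def)
  have "v a \<le> v x + v a" using Groups.add_mono[OF x(2) order_refl, of "v a"] by simp
  then have "x \<otimes> a \<in> valuation_ideal R v"
    using x a' by (auto simp: valuation_ideal_def val_mult)
  then show "x \<otimes>\<^bsub>R\<lparr>carrier := valuation_ring R v\<rparr>\<^esub> a \<in> valuation_ideal R v"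
    "a \<otimes>\<^bsub>R\<lparr>carrier := valuation_ring R v\<rparr>\<^esub> x \<in> valuation_ideal R v"
    using x a' by (simp_all add: m_comm)
qed

text \<open>The characteristic is the additive order of the residue of 1, so a smaller positive m
  has nonzero residue and is a unit of the valuation ring. In residue characteristic 0 the exponent
  is 1 and there is no such m.\<close>

lemma val_nat_eq_zero:
  assumes "subfield K R" "0 < m" "m < characteristic_exponent R v K"
  shows "v ([m] \<cdot> \<one>) = 0"
proof -
  let ?O = "R\<lparr>carrier := valuation_ring R v\<rparr>" and ?I = "valuation_ideal R v"
  interpret I: ideal ?I ?O by (rule ideal_valuation_ideal)
  let ?Q = "?O Quot ?I" and ?h = "\<lambda>x. ?I +>\<^bsub>R\<^esub> x"
  \<comment> \<open>A coset depends on addition only, which is the same in \<open>R\<close> and in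
    its valuation ring.\<close>
  have h: "?h = (+>\<^bsub>?O\<^esub>) ?I" by (simp add: fun_eq_iff a_r_coset_def r_coset_def)
  interpret h: ring_hom_ring ?O ?Q ?h
    unfolding h by (rule I.rcos_ring_hom_ring)
  have "subring (K \<inter> valuation_ring R v) ?O"
    using subring_inter[OF subfieldE(1)[OF assms(1)] subring_valuation_ring]
    by (intro I.ring_incl_imp_subring) (auto dest: subring_is_ring)
  then have img: "subring (?h ` (K \<inter> valuation_ring R v)) ?Q" by (rule h.img_is_subring)
  let ?k = "residue_field R v K"
  have k: "?k = ?Q\<lparr>carrier := ?h ` (K \<inter> valuation_ring R v)\<rparr>" by (simp add: residue_field_def)
  interpret k: ring ?k unfolding k by (rule h.S.subring_is_ring[OF img])
  have k_ops: "\<zero>\<^bsub>?k\<^esub> = ?I" "\<one>\<^bsub>?k\<^esub> = ?h \<one>" "(\<oplus>\<^bsub>?k\<^esub>) = (\<oplus>\<^bsub>?Q\<^esub>)"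
    using h.hom_one by (simp_all add: k FactRing_def)
  have nat_O: "[n] \<cdot> \<one> \<in> valuation_ring R v" for n :: nat
    using val_nat_nonneg by (simp add: valuation_ring_def)
  have nat: "add_pow ?k n \<one>\<^bsub>?k\<^esub> = ?h ([n] \<cdot> \<one>)" for n :: nat
  proof (induction n)
    case 0
    have "?h \<zero> = \<zero>\<^bsub>?Q\<^esub>" using h.hom_zero by simp
    then show ?case using k_ops by (simp add: FactRing_def)
  next
    case (Suc n)
    have "?h ([n] \<cdot> \<one> \<oplus> \<one>) = ?h ([n] \<cdot> \<one>) \<oplus>\<^bsub>?Q\<^esub> ?h \<one>"
      using h.hom_add[of "[n] \<cdot> \<one>" \<one>] nat_O[of n] nat_O[of 1] by simp
    then show ?case using Suc k_ops by simp
  qed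
  have "characteristic ?k \<noteq> 0" "m < characteristic ?k"
    using assms(2,3) by (auto simp: characteristic_exponent_def split: if_splits)
  then have "\<not> characteristic ?k dvd m"
    using assms(2) by (simp add: nat_dvd_not_less)
  then have "add_pow ?k m \<one>\<^bsub>?k\<^esub> \<noteq> \<zero>\<^bsub>?k\<^esub>"
    using k.add.pow_eq_id[of "\<one>\<^bsub>?k\<^esub>" m] by (simp add: characteristic_def add_pow_def)
  then have "?h ([m] \<cdot> \<one>) \<noteq> ?I" using nat k_ops by simp
  then have "[m] \<cdot> \<one> \<notin> ?I"
    using I.a_coset_join2[of "[m] \<cdot> \<one>"] nat_O[of m] unfolding h
    by (metis I.a_rcos_const)
  then show ?thesis
    using val_nat_nonneg[of m] by (auto simp: valuation_ideal_def)
qed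

text \<open>Equal value groups give k in \<open>K\<close> with x / k of value 0, and equal residue
  fields give u' in \<open>K\<close> with the same residue as x / k. Then k u' approximates x better
  than 0 does.\<close>

lemma immediate_no_best_approximation:
  assumes "subfield K R" "subfield L R" "K \<subseteq> L" "immediate R v K L" "x \<in> L" "x \<noteq> \<zero>"
  shows "\<exists>k\<in>K. v x < v (x \<ominus> k)"
proof -
  let ?I = "valuation_ideal R v"
  have LR: "L \<subseteq> carrier R" using subfieldE(3)[OF assms(2)] .
  have x: "x \<in> carrier R" using assms(5) LR by blast
  have "v x \<in> value_group R v K"
    using assms(4-6) by (auto simp: immediate_def value_group_def)
  then obtain k where k: "k \<in> K" "k \<noteq> \<zero>" "v x = v k" by (auto simp: value_group_def)
  have kR: "k \<in> carrier R" using k(1) assms(3) LR by blast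
  obtain g where g: "v k = Fin g" using val_finiteE[OF kR k(2)] .
  define u where "u = x \<otimes> inv k"
  have inv_k: "inv k \<in> L" using subfield_m_inv(1)[OF assms(1)] k assms(3) by blast
  have uL: "u \<in> L" using subringE(6)[OF subfieldE(1)[OF assms(2)] assms(5) inv_k] by (simp add: u_def)
  then have uR: "u \<in> carrier R" using LR by blast
  have "v u = 0" using val_div[OF x kR k(2)] k(3) g by (simp add: u_def zero_extended_def)
  then have "u \<in> L \<inter> valuation_ring R v" using uL uR by (simp add: valuation_ring_def)
  then have "?I +>\<^bsub>R\<^esub> u \<in> carrier (residue_field R v L)" by (simp add: residue_field_def)
  then have "?I +>\<^bsub>R\<^esub> u \<in> carrier (residue_field R v K)" using assms(4) by (simp add: immediate_def)
  then obtain u' where u': "u' \<in> K" "u' \<in> carrier R" "?I +>\<^bsub>R\<^esub> u = ?I +>\<^bsub>R\<^esub> u'"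
    by (auto simp: residue_field_def valuation_ring_def)
  have "\<zero> \<in> ?I" by (simp add: valuation_ideal_def zero_extended_def)
  then have "u \<in> ?I +>\<^bsub>R\<^esub> u" using uR by (force simp: a_r_coset_def')
  then obtain h where h: "h \<in> ?I" "u = h \<oplus> u'" using u'(3) by (auto simp: a_r_coset_def')
  have hR: "h \<in> carrier R" "0 < v h" using h(1) by (auto simp: valuation_ideal_def)
  have "x = k \<otimes> u"
    using m_lcomm[OF kR x val_inv(1)[OF kR k(2)]] x kR k(2) by (simp add: u_def field_Units)
  then have "x \<ominus> k \<otimes> u' = k \<otimes> h"
    using h(2) hR(1) kR u'(2) by (simp add: r_distr a_minus_def a_assoc r_neg)
  then have "v (x \<ominus> k \<otimes> u') = v k + v h" using kR hR(1) by (simp add: val_mult)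
  moreover have "v k < v k + v h" using g hR(2) by (cases "v h") (auto simp: zero_extended_def)
  moreover have "k \<otimes> u' \<in> K" using subringE(6)[OF subfieldE(1)[OF assms(1)] k(1) u'(1)] .
  ultimately show ?thesis using k(3) by metis
qed

end

section \<open>Automorphisms and fixed fields\<close>

context field
begin

section \<open>Automorphisms acting on polynomials, and fixed fields\<close>

lemma galois_group_memD:
  assumes "subfield L R" "\<phi> \<in> carrier (galois_group R K L)"
  shows "ring_hom_ring (R\<lparr>carrier := L\<rparr>) R \<phi>" "bij_betw \<phi> L L" "\<phi> \<in> extensional L"
    "\<And>x. x \<in> K \<Longrightarrow> \<phi> x = x" "\<phi> \<in> Bij L"
proof -
  have \<phi>: "\<phi> \<in> ring_iso (R\<lparr>carrier := L\<rparr>) (R\<lparr>carrier := L\<rparr>)" "\<phi> \<in> extensional L"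
    "\<forall>x\<in>K. \<phi> x = x"
    using assms(2) by (auto simp: galois_group_def)
  then show bij: "bij_betw \<phi> L L" "\<phi> \<in> extensional L" "\<And>x. x \<in> K \<Longrightarrow> \<phi> x = x"
    by (auto simp: ring_iso_def)
  then show "\<phi> \<in> Bij L" by (simp add: Bij_def)
  show "ring_hom_ring (R\<lparr>carrier := L\<rparr>) R \<phi>"
    using \<phi>(1) subfieldE(3)[OF assms(1)] subring_is_ring[OF subfieldE(1)[OF assms(1)]] ring_axioms
    by (auto intro!: ring_hom_ring.intro ring_hom_ring_axioms.intro
      simp: ring_iso_def ring_hom_def Pi_iff subset_iff)
qed

lemma fixed_field_subfield:
  assumes "subfield L R" "H \<subseteq> carrier (galois_group R K L)"
  shows "subfield (fixed_field L H) R"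
proof (rule subfieldI')
  note L = subfieldE(1)[OF assms(1)]
  have LR: "L \<subseteq> carrier R" using subfieldE(3)[OF assms(1)] .
  have hom: "\<phi> \<in> ring_hom (R\<lparr>carrier := L\<rparr>) R" if "\<phi> \<in> H" for \<phi>
    using galois_group_memD(1)[OF assms(1)] assms(2) that ring_hom_ring.homh by blast
  have add: "\<phi> (x \<oplus> y) = \<phi> x \<oplus> \<phi> y" and mult: "\<phi> (x \<otimes> y) = \<phi> x \<otimes> \<phi> y"
    if "\<phi> \<in> H" "x \<in> L" "y \<in> L" for \<phi> x y
    using ring_hom_add[OF hom[OF that(1)], of x y]
      ring_hom_mult[OF hom[OF that(1)], of x y] that by simp_all
  have one: "\<phi> \<one> = \<one>" and zero: "\<phi> \<zero> = \<zero>" if "\<phi> \<in> H" for \<phi>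
    using ring_hom_one[OF hom[OF that(1)]] ring_hom_zero[OF hom[OF that(1)] subring_is_ring[OF L] ring_axioms]
    by simp_all
  show "subring (fixed_field L H) R"
  proof (rule subringI)
    fix x assume x: "x \<in> fixed_field L H"
    have "\<phi> (\<ominus> x) = \<ominus> x" if \<phi>: "\<phi> \<in> H" for \<phi>
    proof -
      have xL: "x \<in> L" "\<ominus> x \<in> L" using x subringE(5)[OF L] by (auto simp: fixed_field_def)
      have "\<phi> (\<ominus> x) \<oplus> \<phi> x = \<zero>"
        using add[OF \<phi> xL(2,1)] zero[OF \<phi>] xL LR by (simp add: l_neg subset_iff)
      moreover have "\<phi> x = x" using x \<phi> by (simp add: fixed_field_def)
      moreover have "\<phi> (\<ominus> x) \<in> carrier R"
        using ring_hom_closed[OF hom[OF \<phi>]] xL by simp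
      ultimately show ?thesis using xL LR minus_equality[of "\<phi> (\<ominus> x)" x] by (metis subsetD)
    qed
    then show "\<ominus> x \<in> fixed_field L H"
      using x subringE(5)[OF L] by (simp add: fixed_field_def)
  next
    fix x y assume xy: "x \<in> fixed_field L H" "y \<in> fixed_field L H"
    have "\<phi> (x \<oplus> y) = x \<oplus> y" "\<phi> (x \<otimes> y) = x \<otimes> y" if "\<phi> \<in> H" for \<phi>
    proof -
      have "\<phi> x = x" "\<phi> y = y" "x \<in> L" "y \<in> L" using xy that by (auto simp: fixed_field_def)
      then show "\<phi> (x \<oplus> y) = x \<oplus> y" "\<phi> (x \<otimes> y) = x \<otimes> y"
        using add[OF that, of x y] mult[OF that, of x y] by simp_all
    qed
    then show "x \<otimes> y \<in> fixed_field L H" "x \<oplus> y \<in> fixed_field L H"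
      using xy subringE(6,7)[OF L] by (simp_all add: fixed_field_def)
  qed (use LR one subringE(3)[OF L] in \<open>auto simp: fixed_field_def\<close>)
  fix k assume "k \<in> fixed_field L H - {\<zero>}"
  then have k: "k \<in> L" "k \<noteq> \<zero>" "k \<in> carrier R" "\<And>\<phi>. \<phi> \<in> H \<Longrightarrow> \<phi> k = k"
    using LR by (auto simp: fixed_field_def)
  have ik: "inv k \<in> L" using subfield_m_inv(1)[OF assms(1)] k by blast
  have "\<phi> (inv k) = inv k" if \<phi>: "\<phi> \<in> H" for \<phi>
  proof -
    have "k \<otimes> \<phi> (inv k) = \<one>"
    proof -
      have "k \<otimes> inv k = \<one>" using k(2,3) by (simp add: field_Units)
      then show ?thesis using mult[OF \<phi> k(1) ik] k(4)[OF \<phi>] one[OF \<phi>] by metis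
    qed
    moreover have "\<phi> (inv k) \<in> carrier R"
      using ring_hom_closed[OF hom[OF \<phi>]] ik by simp
    ultimately show ?thesis using comm_inv_char[of k "\<phi> (inv k)"] k(3) by simp
  qed
  then show "inv k \<in> fixed_field L H" using ik by (simp add: fixed_field_def)
qed

lemma automorphism_eval:
  assumes "subfield L R" "H \<subseteq> carrier (galois_group R K L)" "\<phi> \<in> H"
    and "polynomial (fixed_field L H) p" "x \<in> L"
  shows "\<phi> (eval p x) = eval p (\<phi> x)"
proof -
  have p: "set p \<subseteq> fixed_field L H" using polynomial_incl[OF assms(4)] .
  interpret h: ring_hom_ring "R\<lparr>carrier := L\<rparr>" R \<phi>
    using galois_group_memD(1)[OF assms(1)] assms(2,3) by blast
  have "map \<phi> p = p" using p assms(3) by (intro map_idI) (auto simp: fixed_field_def)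
  moreover have "set p \<subseteq> L" using p by (auto simp: fixed_field_def)
  ultimately show ?thesis
    using h.eval_hom'[of x p] assms(5) eval_consistent[OF subfieldE(1)[OF assms(1)]] by simp
qed

lemma map_hom_linear_product:
  assumes "subring L R" "ring_hom_ring (R\<lparr>carrier := L\<rparr>) R h" "set rs \<subseteq> L"
  shows "set (linear_product rs) \<subseteq> L" "map h (linear_product rs) = linear_product (map h rs)"
proof -
  interpret h: ring_hom_ring "R\<lparr>carrier := L\<rparr>" R h by (rule assms(2))
  have LR: "L \<subseteq> carrier R" using subringE(1)[OF assms(1)] .
  have "set (linear_product rs) \<subseteq> L \<and> map h (linear_product rs) = linear_product (map h rs)"
    using assms(3)
  proof (induction rs)
    case Nil
    show ?case using h.hom_one subringE(3)[OF assms(1)] by simp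
  next
    case (Cons r rs)
    have r: "r \<in> L" "set rs \<subseteq> L" and IH: "set (linear_product rs) \<subseteq> L"
      "map h (linear_product rs) = linear_product (map h rs)"
      using Cons by auto
    let ?l = "[\<one>, \<ominus> r]"
    have l: "set ?l \<subseteq> L" using r(1) subringE(3,5)[OF assms(1)] by auto
    have "\<ominus> r \<in> L" using l by simp
    moreover have hr: "h r \<in> carrier R" using h.hom_closed[of r] r(1) by simp
    moreover have "h (\<ominus> r) \<in> carrier R" using h.hom_closed[of "\<ominus> r"] l by simp
    moreover have "h (\<ominus> r) \<oplus> h r = \<zero>"
      using h.hom_add[of "\<ominus> r" r] h.hom_zero r(1) l LR by (auto simp: l_neg subset_iff)
    ultimately have "h (\<ominus> r) = \<ominus> h r" using minus_equality by metis
    then have hl: "map h ?l = [\<one>, \<ominus> h r]" using h.hom_one by simp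
    have pm: "ring.poly_mult (R\<lparr>carrier := L\<rparr>) = poly_mult"
      using poly_mult_consistent[OF assms(1)] .
    have "set (poly_mult ?l (linear_product rs)) \<subseteq> L"
      using polynomial_incl[OF poly_mult_is_polynomial[OF assms(1) l IH(1)]] .
    then have sub: "set (linear_product (r # rs)) \<subseteq> L" by (simp only: linear_product_Cons)
    have "h ` L \<subseteq> carrier R" using h.hom_closed by auto
    then have "set (map h rs) \<subseteq> carrier R" "h r \<in> carrier R" using r by auto
    then have closed: "set (map h (r # rs)) \<subseteq> carrier R" by simp
    have "normalize (map h (poly_mult ?l (linear_product rs))) =
        poly_mult (map h ?l) (map h (linear_product rs))"
      using h.poly_mult_hom'[of ?l "linear_product rs"] l IH(1) by (simp only: pm) simp
    also have "\<dots> = linear_product (map h (r # rs))"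
      by (simp only: hl IH(2)) (simp del: poly_mult.simps)
    finally have n: "normalize (map h (linear_product (r # rs))) = linear_product (map h (r # rs))"
      by (simp only: linear_product_Cons)
    \<comment> \<open>Equal lengths show that normalisation removes no leading zero: both
      polynomials are monic of the same degree.\<close>
    have "length (linear_product (r # rs)) = length (linear_product (map h (r # rs)))"
      using linear_product_monic(1)[OF closed] linear_product_monic(1)[of "r # rs"] Cons.prems LR
      by (metis length_map subset_trans)
    then have "normalize (map h (linear_product (r # rs))) = map h (linear_product (r # rs))"
      using n normalize_length_lt
      by (metis length_map length_greater_0_conv less_irrefl normalize.simps normalize_def' append_Nil diff_self_eq_0 replicate_0)
    then show ?case using n sub by simp
  qed
  then show "set (linear_product rs) \<subseteq> L" "map h (linear_product rs) = linear_product (map h rs)"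
    by auto
qed

lemma subgroup_galois_group_closed:
  assumes "subfield L R" "subgroup H (galois_group R K L)" "\<phi> \<in> H" "\<psi> \<in> H"
  shows "compose L \<phi> \<psi> \<in> H"
proof -
  have "\<phi> \<in> Bij L" "\<psi> \<in> Bij L"
    using galois_group_memD(5)[OF assms(1)] subgroup.subset[OF assms(2)] assms(3,4) by blast+
  then show ?thesis
    using subgroup.m_closed[OF assms(2-4)] by (simp add: galois_group_def BijGroup_def)
qed

text \<open>Composition with \<psi> in \<open>H\<close> permutes \<open>H\<close>, hence the list of
  conjugates of x, so \<psi> fixes every coefficient of the product.\<close>

lemma orbit_polynomial_over_fixed_field:
  assumes "subfield L R" "subgroup H (galois_group R K L)" "distinct \<phi>s" "set \<phi>s = H" "x \<in> L"
  shows "polynomial (fixed_field L H) (linear_product (map (\<lambda>\<phi>. \<phi> x) \<phi>s))"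
proof -
  note H = subgroup.subset[OF assms(2)]
  have mem: "\<phi> y \<in> L" if "\<phi> \<in> H" "y \<in> L" for \<phi> y
    using galois_group_memD(2)[OF assms(1)] H that by (meson bij_betwE subsetD)
  let ?rs = "map (\<lambda>\<phi>. \<phi> x) \<phi>s"
  have rs: "set ?rs \<subseteq> L" using mem assms(4,5) by auto
  have rsR: "set ?rs \<subseteq> carrier R" using rs subfieldE(3)[OF assms(1)] by blast
  have invariant: "map \<psi> (linear_product ?rs) = linear_product ?rs" if \<psi>: "\<psi> \<in> H" for \<psi>
  proof -
    have "inj_on (compose L \<psi>) H"
    proof (rule inj_onI)
      fix \<phi> \<phi>' assume s: "\<phi> \<in> H" "\<phi>' \<in> H" "compose L \<psi> \<phi> = compose L \<psi> \<phi>'"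
      have "\<phi> y = \<phi>' y" if "y \<in> L" for y
      proof -
        have "inj_on \<psi> L" using galois_group_memD(2)[OF assms(1)] H \<psi> bij_betw_def by blast
        moreover have "\<psi> (\<phi> y) = \<psi> (\<phi>' y)" using fun_cong[OF s(3), of y] that by (simp add: compose_eq)
        ultimately show ?thesis using mem[OF _ that] s(1,2) by (simp add: inj_on_eq_iff)
      qed
      then show "\<phi> = \<phi>'"
        using galois_group_memD(3)[OF assms(1)] H s(1,2) by (meson extensionalityI subsetD)
    qed
    moreover have "compose L \<psi> ` H \<subseteq> H"
      using subgroup_galois_group_closed[OF assms(1,2) \<psi>] by blast
    moreover have fin: "finite H" using assms(4) by auto
    ultimately have img: "compose L \<psi> ` H = H" by (simp add: endo_inj_surj)
    \<comment> \<open>Multisets are compared because different automorphisms may give the same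
      conjugate of x.\<close>
    have "mset (map (compose L \<psi>) \<phi>s) = mset \<phi>s"
      using \<open>inj_on (compose L \<psi>) H\<close> img assms(3,4)
      by (metis distinct_map set_eq_iff_mset_eq_distinct set_map)
    then have "mset (map (\<lambda>\<phi>. \<phi> x) (map (compose L \<psi>) \<phi>s)) = mset ?rs"
      by (simp only: mset_map)
    moreover have "map (\<lambda>\<phi>. \<phi> x) (map (compose L \<psi>) \<phi>s) = map \<psi> ?rs"
      using assms(5) by (simp add: compose_eq)
    ultimately have "mset ?rs = mset (map \<psi> ?rs)" by metis
    then have "linear_product ?rs = linear_product (map \<psi> ?rs)"
      using linear_product_mset_cong[of ?rs "map \<psi> ?rs"] rsR by blast
    moreover have "map \<psi> (linear_product ?rs) = linear_product (map \<psi> ?rs)"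
      using map_hom_linear_product(2)[OF subfieldE(1)[OF assms(1)] _ rs]
        galois_group_memD(1)[OF assms(1)] H \<psi> by blast
    ultimately show ?thesis by simp
  qed
  obtain \<psi> where "\<psi> \<in> H" using subgroup.one_closed[OF assms(2)] by blast
  then have "set (linear_product ?rs) \<subseteq> L"
    using map_hom_linear_product(1)[OF subfieldE(1)[OF assms(1)] _ rs]
      galois_group_memD(1)[OF assms(1)] H by blast
  then have "set (linear_product ?rs) \<subseteq> fixed_field L H"
    using invariant by (auto simp: fixed_field_def dest!: map_eq_conv[THEN iffD1, of _ _ id, simplified])
  then show ?thesis
    using linear_product_monic[OF rsR] by (intro polynomialI) auto
qed

section \<open>Simple algebraic extensions\<close>

lemma simple_field_extension_eval:
  assumes "subfield K R" "x \<in> carrier R" "(algebraic over K) x"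
    "y \<in> generate_field R (insert x K)"
  obtains p where "polynomial K p" "y = eval p x"
proof -
  note K = subfieldE(1)[OF assms(1)]
  \<comment> \<open>As x is algebraic, the ring K[x] is already a field and so contains the field
    generated by x over \<open>K\<close>.\<close>
  have "subfield (simple_extension K x) R"
    using simple_extension_is_subfield[OF assms(1,2)] assms(3) by blast
  moreover have "insert x K \<subseteq> simple_extension K x"
    using simple_extension_mem[OF K assms(2)] simple_extension_incl[OF subringE(1)[OF K] assms(2)]
    by blast
  moreover have "insert x K \<subseteq> carrier R" using subringE(1)[OF K] assms(2) by blast
  ultimately have "y \<in> simple_extension K x"
    using generate_field_min_subfield1 assms(4) by blast
  then show thesis
    using simple_extension_as_eval_img[OF subringE(1)[OF K] assms(2)] that
    by (auto simp flip: univ_poly_carrier)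
qed

text \<open>Every element of \<open>L\<close> is a polynomial in x with coefficients fixed by all
  automorphisms, so the image of x determines the automorphism.\<close>

lemma inj_on_eval_at_generator:
  assumes "subfield K R" "subfield L R" "x \<in> L" "(algebraic over K) x"
    "L = generate_field R (insert x K)"
  shows "inj_on (\<lambda>\<phi>. \<phi> x) (carrier (galois_group R K L))"
proof (rule inj_onI)
  let ?G = "carrier (galois_group R K L)"
  fix \<phi> \<psi> assume s: "\<phi> \<in> ?G" "\<psi> \<in> ?G" "\<phi> x = \<psi> x"
  have x: "x \<in> carrier R" using assms(3) subfieldE(3)[OF assms(2)] by blast
  have "\<phi> y = \<psi> y" if y: "y \<in> L" for y
  proof -
    obtain p where p: "polynomial K p" "y = eval p x"
      using simple_field_extension_eval[OF assms(1) x assms(4)] y assms(5) by blast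
    have "K \<subseteq> fixed_field L ?G"
      using galois_group_memD(4)[OF assms(2)] assms(5) generate_field.incl[of _ "insert x K" R]
      by (auto simp: fixed_field_def)
    then have "polynomial (fixed_field L ?G) p"
      using p(1) by (auto simp: polynomial_def)
    then show ?thesis
      using automorphism_eval[OF assms(2) subset_refl _ _ assms(3)] s p(2) by metis
  qed
  then show "\<phi> = \<psi>"
    using galois_group_memD(3)[OF assms(2)] s(1,2) by (meson extensionalityI)
qed

text \<open>The images of x are roots of one nonzero polynomial over \<open>K\<close>, and they
  determine the automorphisms.\<close>

lemma finite_galois_group_simple:
  assumes "subfield K R" "subfield L R" "x \<in> L" "(algebraic over K) x"
    "L = generate_field R (insert x K)"
  shows "finite (carrier (galois_group R K L))"
proof -
  let ?G = "carrier (galois_group R K L)"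
  note K = subfieldE(1)[OF assms(1)]
  have x: "x \<in> carrier R" using assms(3) subfieldE(3)[OF assms(2)] by blast
  obtain p where p: "p \<in> carrier (K[X])" "p \<noteq> []" "eval p x = \<zero>"
    using algebraicE[OF K x assms(4)] by blast
  have "K \<subseteq> fixed_field L ?G"
    using galois_group_memD(4)[OF assms(2)] assms(5) generate_field.incl[of _ "insert x K" R]
    by (auto simp: fixed_field_def)
  then have pol: "polynomial (fixed_field L ?G) p"
    using p(1) by (auto simp: polynomial_def simp flip: univ_poly_carrier)
  have "is_root p (\<phi> x)" if "\<phi> \<in> ?G" for \<phi>
  proof -
    interpret h: ring_hom_ring "R\<lparr>carrier := L\<rparr>" R \<phi> by (rule galois_group_memD(1)[OF assms(2) that])
    have "eval p (\<phi> x) = \<zero>"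
      using automorphism_eval[OF assms(2) subset_refl that pol assms(3)] p(3) h.hom_zero by simp
    then show ?thesis using h.hom_closed[of x] assms(3) p(2) by (simp add: is_root_def)
  qed
  then have "(\<lambda>\<phi>. \<phi> x) ` ?G \<subseteq> {y. is_root p y}" by blast
  moreover have "p \<in> carrier (poly_ring R)"
    using p(1) carrier_polynomial[OF K] by (simp flip: univ_poly_carrier)
  ultimately have "finite ((\<lambda>\<phi>. \<phi> x) ` ?G)"
    using finite_number_of_roots finite_subset by blast
  then show ?thesis using finite_imageD inj_on_eval_at_generator[OF assms] by blast
qed

end

section \<open>The ideals\<close>

theorem theorem6p4:
  fixes \<Omega> :: "('a, 'm) ring_scheme" (structure)
    and v :: "'a \<Rightarrow> ('g::linordered_ab_group_add) extended"
    and K L :: "'a set" and \<theta> :: 'a and H :: "('a \<Rightarrow> 'a) set"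
  defines "p \<equiv> characteristic_exponent \<Omega> v K"
    and "K\<^sub>H \<equiv> fixed_field L H"
    and "S\<^sub>H \<equiv> diff_set (Min (S_values \<Omega> v L \<theta> H)) (D1_values \<Omega> v \<theta> (fixed_field L H))"
  assumes "algebraic_closure \<Omega> K"
    and "valuation \<Omega> v"
    and "ring.finite_galois_extension \<Omega> K L"
    and "\<theta> \<in> L" and "L = generate_field \<Omega> (insert \<theta> K)"
    and "immediate \<Omega> v K L"
    and "subgroup H (galois_group \<Omega> K L)"
    and "H \<noteq> {\<one>\<^bsub>galois_group \<Omega> K L\<^esub>}"
  shows "I_set v L S\<^sub>H \<subseteq> I_subgroup \<Omega> v L H \<and>
    (card H \<le> p \<and>
       (\<forall>a\<in>K\<^sub>H. \<forall>\<sigma>\<in>H. v ((\<sigma> \<theta> \<ominus> \<theta>) \<otimes> inv (\<theta> \<ominus> a)) \<ge> 0)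
     \<longrightarrow> I_set v L S\<^sub>H = I_subgroup \<Omega> v L H)"
proof -
  interpret algebraic_closure \<Omega> K by (rule assms(4))
  interpret V: valuation \<Omega> v by (rule assms(5))
  have KL: "subfield K \<Omega>" "subfield L \<Omega>" "K \<subseteq> L"
    using assms(6) by (auto simp: finite_galois_extension_def)
  have LR: "L \<subseteq> carrier \<Omega>" using subfieldE(3)[OF KL(2)] .
  note L = subfieldE(1)[OF KL(2)]
  have \<theta>: "\<theta> \<in> carrier \<Omega>" using assms(7) LR by blast
  have alg: "(algebraic over K) \<theta>" using algebraic_extension[OF \<theta>] .
  let ?e = "\<lambda>x\<in>L. x"
  have HG: "H \<subseteq> carrier (galois_group \<Omega> K L)" using subgroup.subset[OF assms(10)] .
  have e: "?e \<in> H" "H \<noteq> {?e}"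
    using subgroup.one_closed[OF assms(10)] assms(11) by (simp_all add: galois_group_def BijGroup_def)
  have fin: "finite H"
    using finite_subset[OF HG finite_galois_group_simple[OF KL(1,2) assms(7) alg assms(8)]] .
  have inj: "inj_on (\<lambda>\<phi>. \<phi> \<theta>) H"
    using inj_on_subset[OF inj_on_eval_at_generator[OF KL(1,2) assms(7) alg assms(8)] HG] .
  have mem: "\<phi> x \<in> L" if "\<phi> \<in> H" "x \<in> L" for \<phi> x
    using galois_group_memD(2)[OF KL(2)] HG that by (meson bij_betwE subsetD)
  define S where "S = S_values \<Omega> v L \<theta> H"
  have S: "S = (\<lambda>\<phi>. v (\<phi> \<theta> \<ominus> \<theta>)) ` (H - {?e})" by (auto simp: S_def S_values_def)
  have finS: "finite S" and neS: "S \<noteq> {}" using fin e by (auto simp: S)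
  let ?F = "fixed_field L H"
  have F: "subfield ?F \<Omega>" using fixed_field_subfield[OF KL(2) HG] .
  have FL: "?F \<subseteq> L" by (auto simp: fixed_field_def)
  have KF: "K \<subseteq> ?F"
    using galois_group_memD(4)[OF KL(2)] HG KL(3) by (auto simp: fixed_field_def)
  have moved: "\<phi> \<theta> \<noteq> \<theta>" if "\<phi> \<in> H - {?e}" for \<phi>
    using inj_onD[OF inj, of \<phi> ?e] that e(1) assms(7) by auto
  \<comment> \<open>An automorphism attaining the minimum; it alone witnesses the first
    inclusion.\<close>
  obtain \<mu> where \<mu>: "\<mu> \<in> H - {?e}" "v (\<mu> \<theta> \<ominus> \<theta>) = Min S"
    using Min_in[OF finS neS] S by (metis (no_types, lifting) imageE)
  have \<theta>F: "\<theta> \<notin> ?F" using moved[OF \<mu>(1)] \<mu>(1) by (auto simp: fixed_field_def)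
  have diffL: "x \<ominus> y \<in> L" if "x \<in> L" "y \<in> L" for x y
    using that subringE(5,7)[OF L] by (simp add: a_minus_def)
  have SH: "S\<^sub>H = (\<lambda>a. Min S - v (\<theta> \<ominus> a)) ` ?F"
    unfolding S\<^sub>H_def diff_set_def D1_values_def S_def by auto

  \<comment> \<open>The unconditional inclusion\<close>
  have incl: "I_set v L S\<^sub>H \<subseteq> I_subgroup \<Omega> v L H"
  proof
    fix c assume "c \<in> I_set v L S\<^sub>H"
    then obtain a where c: "c \<in> L" and a: "a \<in> ?F" "Min S - v (\<theta> \<ominus> a) \<le> v c"
      by (auto simp: I_set_def SH)
    have aL: "a \<in> L" "a \<in> carrier \<Omega>" using a(1) FL LR by auto
    let ?b = "\<theta> \<ominus> a"
    have b: "?b \<in> L" "?b \<in> carrier \<Omega>" "?b \<noteq> \<zero>"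
      using diffL[OF assms(7) aL(1)] LR \<theta> aL(2) \<theta>F a(1) r_right_minus_eq[OF \<theta> aL(2)] by auto
    \<comment> \<open>\<theta> - a is the value of X - a at \<theta>, and this polynomial has
      coefficients in the fixed field; so \<mu> sends it to \<mu> \<theta> - a.\<close>
    have lin: "polynomial ?F [\<one>, \<ominus> a]"
      using subringE(3,5)[OF subfieldE(1)[OF F]] a(1) by (auto simp: polynomial_def)
    have "\<mu> \<theta> \<in> L" using mem \<mu>(1) assms(7) by blast
    then have "\<mu> ?b = \<mu> \<theta> \<ominus> a"
      using automorphism_eval[OF KL(2) HG _ lin assms(7), of \<mu>] \<mu>(1) \<theta> aL LR
      by (auto simp: a_minus_def subset_iff)
    then have "\<mu> ?b \<ominus> ?b = \<mu> \<theta> \<ominus> \<theta>"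
      using minus_minus_cancel(2)[of a "\<mu> \<theta>" \<theta>] \<open>\<mu> \<theta> \<in> L\<close> LR \<theta> aL(2) by auto
    then have "v ((\<mu> ?b \<ominus> ?b) \<otimes> inv ?b) = Min S - v ?b"
      using V.val_div[OF _ b(2,3), of "\<mu> \<theta> \<ominus> \<theta>"] \<mu>(2) \<open>\<mu> \<theta> \<in> L\<close> LR \<theta> by auto
    then have "v ((\<mu> ?b \<ominus> ?b) \<otimes> inv ?b) \<le> v c" using a(2) by simp
    then have "c \<in> I_aut \<Omega> v L \<mu>" unfolding I_aut_def using c b(1,3) by blast
    then show "c \<in> I_subgroup \<Omega> v L H" using \<mu>(1) by (auto simp: I_subgroup_def)
  qed

  \<comment> \<open>The converse inclusion under the additional hypotheses\<close>
  moreover have "I_subgroup \<Omega> v L H \<subseteq> I_set v L S\<^sub>H"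
    if card: "card H \<le> p"
      and int: "\<forall>a\<in>K\<^sub>H. \<forall>\<phi>\<in>H. v ((\<phi> \<theta> \<ominus> \<theta>) \<otimes> inv (\<theta> \<ominus> a)) \<ge> 0"
  proof
    interpret P: pseudo_limit \<Omega> v ?F \<theta>
    proof (intro pseudo_limit.intro pseudo_limit_axioms.intro)
      show "algebraically_closed \<Omega>" "valuation \<Omega> v" "subfield ?F \<Omega>" "\<theta> \<in> carrier \<Omega>"
        using algebraically_closed_axioms assms(5) F \<theta> by auto
    next
      fix a assume a: "a \<in> ?F"
      then have aL: "a \<in> L" "a \<in> carrier \<Omega>" using FL LR by auto
      \<comment> \<open>Immediacy over \<open>K\<close> is applied to \<theta> - a; then a + k lies
        in the fixed field and approximates \<theta> better than a.\<close>
      obtain k where k: "k \<in> K" "v (\<theta> \<ominus> a) < v ((\<theta> \<ominus> a) \<ominus> k)"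
        using V.immediate_no_best_approximation[OF KL assms(9) diffL[OF assms(7) aL(1)]]
          r_right_minus_eq[OF \<theta> aL(2)] \<theta>F a by auto
      have "(\<theta> \<ominus> a) \<ominus> k = \<theta> \<ominus> (a \<oplus> k)"
        using \<theta> aL k(1) KL(3) LR by (simp add: a_minus_def minus_add a_assoc subset_iff)
      moreover have "a \<oplus> k \<in> ?F" using subringE(7)[OF subfieldE(1)[OF F]] a k(1) KF by blast
      ultimately show "\<exists>a'\<in>?F. v (\<theta> \<ominus> a) < v (\<theta> \<ominus> a')" using k(2) by auto
    qed
    \<comment> \<open>The integrality hypothesis with the denominator cleared, which is legitimate
      as the value of \<theta> - a is finite.\<close>
    have close: "v (\<theta> \<ominus> a) \<le> v (\<phi> \<theta> \<ominus> \<theta>)" if "\<phi> \<in> H" "a \<in> ?F" for \<phi> a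
    proof -
      have a: "a \<in> carrier \<Omega>" "\<theta> \<ominus> a \<noteq> \<zero>"
        using that(2) FL LR \<theta>F r_right_minus_eq[OF \<theta>, of a] by auto
      have "\<phi> \<theta> \<in> carrier \<Omega>" using mem[OF that(1) assms(7)] LR by blast
      then have "0 \<le> v (\<phi> \<theta> \<ominus> \<theta>) - v (\<theta> \<ominus> a)"
        using int[unfolded K\<^sub>H_def, THEN bspec, OF that(2), THEN bspec, OF that(1)]
          V.val_div[of "\<phi> \<theta> \<ominus> \<theta>" "\<theta> \<ominus> a"] a \<theta> by simp
      then show ?thesis
        using P.val_gap[OF that(2)] by (cases "v (\<phi> \<theta> \<ominus> \<theta>)") (auto simp: zero_extended_def)
    qed
    have near: "P.near (\<phi> \<theta>)" if \<phi>: "\<phi> \<in> H" for \<phi>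
    proof -
      have c: "\<phi> \<theta> \<in> carrier \<Omega>" using mem[OF \<phi> assms(7)] LR by blast
      \<comment> \<open>The weak inequality \<open>close\<close> for a better approximation than a
        gives the strict one for a.\<close>
      have "v (\<theta> \<ominus> a) < v (\<theta> \<ominus> \<phi> \<theta>)" if "a \<in> ?F" for a
        using P.no_best_approximation[OF that] close[OF \<phi>] V.val_minus_commute[OF \<theta> c]
        by (metis less_le_trans)
      then show ?thesis using c by (simp add: P.near_def)
    qed
    obtain \<phi>s where \<phi>s: "distinct \<phi>s" "set \<phi>s = H" using finite_distinct_list[OF fin] by blast
    let ?gs = "map (\<lambda>\<phi>. \<phi> \<theta>) \<phi>s"
    let ?g = "linear_product ?gs"
    have gs: "set ?gs \<subseteq> carrier \<Omega>" "\<And>r. r \<in> set ?gs \<Longrightarrow> P.near r"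
      using near \<phi>s(2) by (auto simp: P.near_def)
    have n: "length ?gs = card H" using \<phi>s distinct_card by fastforce
    have g: "polynomial ?F ?g"
      using orbit_polynomial_over_fixed_field[OF KL(2) assms(10) \<phi>s assms(7)] .
    \<comment> \<open>Here the bound of the order of \<open>H\<close> by the characteristic exponent
      enters.\<close>
    have unit: "v ([m] \<cdot> \<one>) = 0" if "0 < m" "m < length ?gs" for m :: nat
      using V.val_nat_eq_zero[OF KL(1) that(1)] that(2) n card by (simp add: p_def)
    have g\<theta>: "eval ?g \<theta> = \<zero>"
    proof -
      have "\<theta> \<in> set ?gs"
        using imageI[OF e(1), of "\<lambda>\<phi>. \<phi> \<theta>"] \<phi>s(2) assms(7) by simp
      then show ?thesis using eval_linear_product_root[OF gs(1)] by blast
    qed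
    fix c assume "c \<in> I_subgroup \<Omega> v L H"
    then obtain \<phi> b where \<phi>: "\<phi> \<in> H" and c: "c \<in> L" and b: "b \<in> L" "b \<noteq> \<zero>"
      "v ((\<phi> b \<ominus> b) \<otimes> inv b) \<le> v c"
      by (auto simp: I_subgroup_def I_aut_def)
    have bR: "b \<in> carrier \<Omega>" using b(1) LR by blast
    show "c \<in> I_set v L S\<^sub>H"
    proof (cases "\<phi> = ?e")
      case True
      \<comment> \<open>The identity contributes only c = 0, whose infinite value exceeds every
        element of \<open>S\<^sub>H\<close>.\<close>
      have "\<phi> b \<ominus> b = \<zero>" using True b(1) bR by (simp add: a_minus_def r_neg)
      then have "v c = Pinf" using b(3) V.val_inv(1)[OF bR b(2)] by simp
      then show ?thesis using c P.F_nonempty by (auto simp: I_set_def SH)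
    next
      case False
      obtain f where f: "polynomial K f" "b = eval f \<theta>"
        using simple_field_extension_eval[OF KL(1) \<theta> alg] b(1) assms(8) by blast
      have fF: "polynomial ?F f" using f(1) KF by (auto simp: polynomial_def)
      have "?g \<noteq> []" using linear_product_monic[OF gs(1)] by auto
      \<comment> \<open>Since the orbit polynomial vanishes at \<theta>, the remainder represents b
        by a polynomial of degree less than the order of \<open>H\<close>.\<close>
      then obtain q r where q: "polynomial ?F q" and r: "polynomial ?F r"
        and fqr: "f = poly_add (poly_mult ?g q) r" and r_deg: "r = [] \<or> degree r < degree ?g"
        using field_long_division_theorem[OF F fF g]
        unfolding univ_poly_mult univ_poly_add by metis
      note carr = polynomial_in_carrier[OF subfieldE(1)[OF F]]
      have gq: "polynomial ?F (poly_mult ?g q)" using poly_mult_closed[OF subfieldE(1)[OF F] g q] .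
      have br: "b = eval r \<theta>"
        using eval_poly_add[OF carr[OF gq] carr[OF r] \<theta>] eval_poly_mult[OF carr[OF g] carr[OF q] \<theta>]
          g\<theta> f(2) fqr eval_poly_in_carrier[OF subfieldE(1)[OF F] r \<theta>]
          eval_poly_in_carrier[OF subfieldE(1)[OF F] q \<theta>] by simp
      have r0: "r \<noteq> []" using br b(2) by auto
      have deg: "degree r < length ?gs" using r_deg r0 linear_product_monic(1)[OF gs(1)] by simp
      obtain d rs where d: "d \<in> carrier \<Omega> - {\<zero>}" "set rs \<subseteq> carrier \<Omega>" "length rs = degree r"
        "r = poly_mult [d] (linear_product rs)"
        using factor_into_linear_product[OF P.polynomial_over_carrier[OF r] r0] .
      have far: "filter P.near rs = []"
        using P.no_near_roots[OF gs g unit r r0 deg d] .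
      have "\<phi> \<theta> \<in> carrier \<Omega>" using mem[OF \<phi> assms(7)] LR by blast
      \<comment> \<open>The bound is used with y = \<phi> \<theta>, where the remainder takes the
        value \<phi> b.\<close>
      then obtain a where a: "a \<in> ?F" "v (\<phi> \<theta> \<ominus> \<theta>) - v (\<theta> \<ominus> a) \<le>
          v ((eval r (\<phi> \<theta>) \<ominus> eval r \<theta>) \<otimes> inv (eval r \<theta>))"
        using P.val_log_derivative_bound[OF d(1,2,4) far _ _ close[OF \<phi>]] b(2) br by blast
      have "eval r (\<phi> \<theta>) = \<phi> b" using automorphism_eval[OF KL(2) HG \<phi> r assms(7)] br by simp
      then have "v (\<phi> \<theta> \<ominus> \<theta>) - v (\<theta> \<ominus> a) \<le> v c" using a(2) b(3) br by simp
      moreover have "Min S \<le> v (\<phi> \<theta> \<ominus> \<theta>)" using finS \<phi> False by (auto simp: S)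
      \<comment> \<open>Passing to the minimum lowers the bound to an element of
        \<open>S\<^sub>H\<close>.\<close>
      then have "Min S - v (\<theta> \<ominus> a) \<le> v (\<phi> \<theta> \<ominus> \<theta>) - v (\<theta> \<ominus> a)"
        using Groups.add_right_mono by (simp add: minus_extended_def)
      ultimately show ?thesis using c a(1) by (auto simp: I_set_def SH intro: order_trans)
    qed
  qed
  ultimately show ?thesis by blast
qed

end
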